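(* Let $(E,\rho,[\cdot,\cdot]_E,L)$ be a regular local pre-Leibniz algebroid with a locality projector $\mathcal{P}$, and let $\nabla$ be an admissible linear $E$-connection. Then for all $u,v,w,w'\in\mathfrak{X}(E)$, $$R(\nabla)(u,v)w+cycl.=(\nabla_u\hat T(\nabla))(v,w)+\hat T(\nabla)(\hat T(\nabla)(u,v),w)+[u,[v,w]_E^{\hat\nabla}]_E^{\hat\nabla}+cycl.,$$ $$(\nabla_uR(\nabla))(v,w)w'+cycl.=R(\nabla)(u,\hat T(\nabla)(v,w))w'+\nabla_{[[u,v]_E^{\hat\nabla},w]_E^{\hat\nabla}}w'+cycl.,$$ where on each side "$cycl.$" means that the cyclic permutations in $u,v,w$ of all the displayed terms of that side are added.
   Context: Everything is smooth. $M$ is a manifold, $E\to M$ a real vector bundle of constant rank, $\mathfrak{X}(E)=\Gamma(E)$, $\Omega^1(E)=\Gamma(E^* )$. An anchored vector bundle $(E,\rho)$ has a vector bundle morphism $\rho:E\to T(M)$ over the identity; it is regular if $\ker\rho$ has locally constant rank. A pre-Leibniz algebroid $(E,\rho,[\cdot,\cdot]_E)$ is an anchored vector bundle with an $\mathbb{R}$-bilinear bracket on $\mathfrak{X}(E)$ satisfying $[u,fv]_E=\rho(u)(f)v+f[u,v]_E$ and $\rho([u,v]_E)=[\rho(u),\rho(v)]$. It is local with locality operator $L$, a $C^\infty(M,\mathbb{R})$-multilinear map $L:\Omega^1(E)\times\mathfrak{X}(E)\times\mathfrak{X}(E)\to\mathfrak{X}(E)$, if $[fu,v]_E=-\rho(v)(f)u+f[u,v]_E+L(Df,u,v)$,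 where $(Df)(u):=\rho(u)(f)$. A locality projector is a $C^\infty(M,\mathbb{R})$-linear map $\mathcal{P}:\mathfrak{X}(E)\to\mathfrak{X}(E)$ such that the image of $\mathcal{P}L$ lies in $\ker\rho$ and $\mathcal{P}$ restricts to the identity on $\ker\rho$. A linear $E$-connection is an $\mathbb{R}$-bilinear map $\nabla:\mathfrak{X}(E)\times\mathfrak{X}(E)\to\mathfrak{X}(E)$ with $\nabla_u(fv)=\rho(u)(f)v+f\nabla_uv$ and $\nabla_{fu}v=f\nabla_uv$; it is extended to $E$-tensors by the Leibniz rule. $(X_a)$ denotes a local frame of $E$, $(e^a)$ the dual coframe, repeated indices are summed; $L(e^a,\nabla_{X_a}u,v)$ does not depend on the frame. $\nabla$ is admissible if $[u,v]_E+[v,u]_E=L(e^a,\nabla_{X_a}u,v)+L(e^a,\nabla_{X_a}v,u)$ for all $u,v$. Projected modified bracket: $[u,v]_E^{\hat\nabla}:=[u,v]_E-\mathcal{P}L(e^a,\nabla_{X_a}u,v)$. Projected $E$-torsion: $\hat T(\nabla)(u,v):=\nabla_uv-\nabla_vu-[u,v]_E^{\hat\nabla}$. $E$-curvature: $R(\nabla)(u,v)w:=\nabla_u\nabla_vw-\nabla_v\nabla_uw-\nabla_{[u,v]_E^{\hat\nabla}}w$. *)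

theory Defs
  imports "HOL-Analysis.Analysis" "HOL-Library.Function_Algebras"
begin

text \<open>
  Sums and differences of sections, and products of real functions, are the pointwise ones of
  \<^theory>\<open>HOL-Library.Function_Algebras\<close>.
\<close>

section \<open>Smooth manifolds\<close>

text \<open>
  \<open>Ck_on k S f\<close> is used for open \<open>S\<close> in a finite-dimensional space only, where it says that all
  iterated directional derivatives of order at most \<open>k\<close> exist and are continuous. Functions are
  total; their values outside \<open>S\<close> are irrelevant.
\<close>

primrec Ck_on :: "nat \<Rightarrow> 'a::real_normed_vector set \<Rightarrow> ('a \<Rightarrow> 'b::real_normed_vector) \<Rightarrow> bool" where
  "Ck_on 0 S f \<longleftrightarrow> continuous_on S f"
| "Ck_on (Suc k) S f \<longleftrightarrow>
     (\<forall>x\<in>S. f differentiable (at x)) \<and> (\<forall>v. Ck_on k S (\<lambda>x. frechet_derivative f (at x) v))"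

definition smooth_on :: "'a::real_normed_vector set \<Rightarrow> ('a \<Rightarrow> 'b::real_normed_vector) \<Rightarrow> bool" where
  "smooth_on S f \<longleftrightarrow> (\<forall>k. Ck_on k S f)"

text \<open>
  The manifold is a whole Hausdorff, second countable type. The model space is a real inner
  product space that is only required to be finite-dimensional (and not of class
  \<^class>\<open>euclidean_space\<close>), so that dimension 0 is included. An atlas need not be maximal.
\<close>

definition smooth_atlas ::
  "('m::{second_countable_topology,t2_space} set \<times> ('m \<Rightarrow> 'e::real_inner)) set \<Rightarrow> bool" where
  "smooth_atlas A \<longleftrightarrow>
     (\<exists>B::'e set. finite B \<and> span B = UNIV) \<and>
     (\<Union>(U, \<phi>)\<in>A. U) = UNIV \<and>
     (\<forall>(U, \<phi>)\<in>A. open U \<and> open (\<phi> ` U) \<and> homeomorphism U (\<phi> ` U) \<phi> (inv_into U \<phi>)) \<and>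
     (\<forall>(U, \<phi>)\<in>A. \<forall>(V, \<psi>)\<in>A. smooth_on (\<phi> ` (U \<inter> V)) (\<psi> \<circ> inv_into U \<phi>))"

definition smooth_fun_on ::
  "('m::{second_countable_topology,t2_space} set \<times> ('m \<Rightarrow> 'e::real_inner)) set \<Rightarrow>
     'm set \<Rightarrow> ('m \<Rightarrow> real) \<Rightarrow> bool" where
  "smooth_fun_on A W f \<longleftrightarrow> (\<forall>(U, \<phi>)\<in>A. smooth_on (\<phi> ` (U \<inter> W)) (f \<circ> inv_into U \<phi>))"

section \<open>Vector bundles and their sections\<close>

text \<open>
  The fibres are subspaces of one real vector space \<open>'v\<close>, which carries no topology and may be
  infinite-dimensional; this loses no generality, since the fibres of any bundle embed into their
  direct sum. The total space is \<open>{(p, x). x \<in> fibre E p}\<close>. A local trivialization \<open>(U, \<tau>)\<close> is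
  the map \<open>(p, x) \<mapsto> (p, \<tau> p x)\<close>, where \<open>\<real>\<^sup>r\<close> is represented by \<open>coord_space r\<close>. The
  smooth structure of the total space is the one determined by these trivializations.
\<close>

record ('m, 'e, 'v) vbundle =
  charts :: "('m set \<times> ('m \<Rightarrow> 'e)) set"
  rk :: nat
  fibre :: "'m \<Rightarrow> 'v set"
  trivs :: "('m set \<times> ('m \<Rightarrow> 'v \<Rightarrow> nat \<Rightarrow> real)) set"

definition coord_space :: "nat \<Rightarrow> (nat \<Rightarrow> real) set" where
  "coord_space r = {c. \<forall>a\<ge>r. c a = 0}"

definition triv_frame ::
  "('m, 'e, 'v) vbundle \<Rightarrow> ('m \<Rightarrow> 'v \<Rightarrow> nat \<Rightarrow> real) \<Rightarrow> nat \<Rightarrow> 'm \<Rightarrow> 'v" where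
  "triv_frame E \<tau> a p = inv_into (fibre E p) (\<tau> p) (\<lambda>b. if b = a then 1 else 0)"

definition linear_form_on :: "'v::real_vector set \<Rightarrow> ('v \<Rightarrow> real) \<Rightarrow> bool" where
  "linear_form_on S l \<longleftrightarrow>
     (\<forall>x\<in>S. \<forall>y\<in>S. \<forall>c d. l (c *\<^sub>R x + d *\<^sub>R y) = c * l x + d * l y)"

definition vector_bundle ::
  "('m::{second_countable_topology,t2_space}, 'e::real_inner, 'v::real_vector) vbundle \<Rightarrow> bool" where
  "vector_bundle E \<longleftrightarrow>
     smooth_atlas (charts E) \<and>
     (\<forall>p. subspace (fibre E p)) \<and>
     (\<Union>(U, \<tau>)\<in>trivs E. U) = UNIV \<and>
     (\<forall>(U, \<tau>)\<in>trivs E. open U \<and>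
        (\<forall>p\<in>U. bij_betw (\<tau> p) (fibre E p) (coord_space (rk E)) \<and>
                (\<forall>a. linear_form_on (fibre E p) (\<lambda>x. \<tau> p x a)))) \<and>
     (\<forall>(U, \<tau>)\<in>trivs E. \<forall>(V, \<sigma>)\<in>trivs E. \<forall>a<rk E. \<forall>b<rk E.
        smooth_fun_on (charts E) (U \<inter> V) (\<lambda>p. \<sigma> p (triv_frame E \<tau> a p) b))"

definition Cinf ::
  "('m::{second_countable_topology,t2_space}, 'e::real_inner, 'v) vbundle \<Rightarrow> ('m \<Rightarrow> real) set" where
  "Cinf E = {f. smooth_fun_on (charts E) UNIV f}"

definition sections ::
  "('m::{second_countable_topology,t2_space}, 'e::real_inner, 'v) vbundle \<Rightarrow> ('m \<Rightarrow> 'v) set" where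
  "sections E = {u. (\<forall>p. u p \<in> fibre E p) \<and>
     (\<forall>(U, \<tau>)\<in>trivs E. \<forall>a<rk E. smooth_fun_on (charts E) U (\<lambda>p. \<tau> p (u p) a))}"

text \<open>
  \<open>\<Omega>\<^sup>1(E)\<close>; a covector at \<open>p\<close> is extended by 0 outside \<open>fibre E p\<close>, so that it has a unique
  representative.
\<close>

definition one_forms ::
  "('m::{second_countable_topology,t2_space}, 'e::real_inner, 'v::real_vector) vbundle \<Rightarrow>
     ('m \<Rightarrow> 'v \<Rightarrow> real) set" where
  "one_forms E = {\<omega>.
     (\<forall>p. linear_form_on (fibre E p) (\<omega> p) \<and> (\<forall>x. x \<notin> fibre E p \<longrightarrow> \<omega> p x = 0)) \<and>
     (\<forall>(U, \<tau>)\<in>trivs E. \<forall>a<rk E. smooth_fun_on (charts E) U (\<lambda>p. \<omega> p (triv_frame E \<tau> a p)))}"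

definition scale_section :: "('m \<Rightarrow> real) \<Rightarrow> ('m \<Rightarrow> 'v::real_vector) \<Rightarrow> 'm \<Rightarrow> 'v"
    (infixr "*\<^sub>S" 75) where
  "f *\<^sub>S u = (\<lambda>p. f p *\<^sub>R u p)"

definition scale_form :: "('m \<Rightarrow> real) \<Rightarrow> ('m \<Rightarrow> 'v \<Rightarrow> real) \<Rightarrow> 'm \<Rightarrow> 'v \<Rightarrow> real"
    (infixr "*\<^sub>F" 75) where
  "f *\<^sub>F \<omega> = (\<lambda>p x. f p * \<omega> p x)"

definition real_bilinear_on_sections ::
  "('m::{second_countable_topology,t2_space}, 'e::real_inner, 'v::real_vector) vbundle \<Rightarrow>
     (('m \<Rightarrow> 'v) \<Rightarrow> ('m \<Rightarrow> 'v) \<Rightarrow> ('m \<Rightarrow> 'v)) \<Rightarrow> bool" where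
  "real_bilinear_on_sections E F \<longleftrightarrow>
     (\<forall>u\<in>sections E. \<forall>v\<in>sections E. F u v \<in> sections E \<and>
        (\<forall>w\<in>sections E. F (u + v) w = F u w + F v w \<and> F w (u + v) = F w u + F w v) \<and>
        (\<forall>c. F ((\<lambda>_. c) *\<^sub>S u) v = (\<lambda>_. c) *\<^sub>S F u v \<and>
             F u ((\<lambda>_. c) *\<^sub>S v) = (\<lambda>_. c) *\<^sub>S F u v))"

section \<open>Tangent bundle and anchor\<close>

text \<open>
  Tangent vectors are derivations of the algebra of smooth functions at a point, set to 0 on
  non-smooth functions so that they have a unique representative.
\<close>

definition tangent_space ::
  "('m::{second_countable_topology,t2_space}, 'e::real_inner, 'v) vbundle \<Rightarrow> 'm \<Rightarrow>
     (('m \<Rightarrow> real) \<Rightarrow> real) set" where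
  "tangent_space E p = {X.
     (\<forall>f. f \<notin> Cinf E \<longrightarrow> X f = 0) \<and>
     (\<forall>f\<in>Cinf E. \<forall>g\<in>Cinf E.
        (\<forall>a b. X (\<lambda>q. a * f q + b * g q) = a * X f + b * X g) \<and>
        X (f * g) = f p * X g + g p * X f)}"

definition vector_fields ::
  "('m::{second_countable_topology,t2_space}, 'e::real_inner, 'v) vbundle \<Rightarrow>
     ('m \<Rightarrow> ('m \<Rightarrow> real) \<Rightarrow> real) set" where
  "vector_fields E = {X. (\<forall>p. X p \<in> tangent_space E p) \<and> (\<forall>f\<in>Cinf E. (\<lambda>p. X p f) \<in> Cinf E)}"

definition lie_bracket ::
  "('m \<Rightarrow> ('m \<Rightarrow> real) \<Rightarrow> real) \<Rightarrow> ('m \<Rightarrow> ('m \<Rightarrow> real) \<Rightarrow> real) \<Rightarrow> 'm \<Rightarrow> ('m \<Rightarrow> real) \<Rightarrow> real" where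
  "lie_bracket X Y = (\<lambda>p f. X p (\<lambda>q. Y q f) - Y p (\<lambda>q. X q f))"

definition anchor_field ::
  "('m \<Rightarrow> 'v \<Rightarrow> ('m \<Rightarrow> real) \<Rightarrow> real) \<Rightarrow> ('m \<Rightarrow> 'v) \<Rightarrow> 'm \<Rightarrow> ('m \<Rightarrow> real) \<Rightarrow> real" where
  "anchor_field \<rho> u = (\<lambda>p. \<rho> p (u p))"

definition anchor_deriv ::
  "('m \<Rightarrow> 'v \<Rightarrow> ('m \<Rightarrow> real) \<Rightarrow> real) \<Rightarrow> ('m \<Rightarrow> 'v) \<Rightarrow> ('m \<Rightarrow> real) \<Rightarrow> 'm \<Rightarrow> real" where
  "anchor_deriv \<rho> u f = (\<lambda>p. anchor_field \<rho> u p f)"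

text \<open>
  Smoothness of the fibrewise linear map \<open>\<rho>\<close> is expressed by its sending smooth sections to
  smooth vector fields.
\<close>

definition anchored_vector_bundle ::
  "('m::{second_countable_topology,t2_space}, 'e::real_inner, 'v::real_vector) vbundle \<Rightarrow>
     ('m \<Rightarrow> 'v \<Rightarrow> ('m \<Rightarrow> real) \<Rightarrow> real) \<Rightarrow> bool" where
  "anchored_vector_bundle E \<rho> \<longleftrightarrow>
     vector_bundle E \<and>
     (\<forall>p. \<forall>x\<in>fibre E p. \<rho> p x \<in> tangent_space E p) \<and>
     (\<forall>p f. linear_form_on (fibre E p) (\<lambda>x. \<rho> p x f)) \<and>
     (\<forall>u\<in>sections E. anchor_field \<rho> u \<in> vector_fields E)"

definition anchor_kernel ::
  "('m, 'e, 'v) vbundle \<Rightarrow> ('m \<Rightarrow> 'v \<Rightarrow> ('m \<Rightarrow> real) \<Rightarrow> real) \<Rightarrow> 'm \<Rightarrow> 'v set" where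
  "anchor_kernel E \<rho> p = {x \<in> fibre E p. \<forall>f. \<rho> p x f = 0}"

definition regular_anchor ::
  "('m::topological_space, 'e, 'v::real_vector) vbundle \<Rightarrow>
     ('m \<Rightarrow> 'v \<Rightarrow> ('m \<Rightarrow> real) \<Rightarrow> real) \<Rightarrow> bool" where
  "regular_anchor E \<rho> \<longleftrightarrow>
     (\<forall>p. \<exists>U. open U \<and> p \<in> U \<and> (\<forall>q\<in>U. dim (anchor_kernel E \<rho> q) = dim (anchor_kernel E \<rho> p)))"

definition D_form ::
  "('m, 'e, 'v) vbundle \<Rightarrow> ('m \<Rightarrow> 'v \<Rightarrow> ('m \<Rightarrow> real) \<Rightarrow> real) \<Rightarrow> ('m \<Rightarrow> real) \<Rightarrow> 'm \<Rightarrow> 'v \<Rightarrow> real" where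
  "D_form E \<rho> f = (\<lambda>p x. if x \<in> fibre E p then \<rho> p x f else 0)"

section \<open>Local pre-Leibniz algebroids\<close>

definition pre_leibniz_algebroid ::
  "('m::{second_countable_topology,t2_space}, 'e::real_inner, 'v::real_vector) vbundle \<Rightarrow>
     ('m \<Rightarrow> 'v \<Rightarrow> ('m \<Rightarrow> real) \<Rightarrow> real) \<Rightarrow>
     (('m \<Rightarrow> 'v) \<Rightarrow> ('m \<Rightarrow> 'v) \<Rightarrow> ('m \<Rightarrow> 'v)) \<Rightarrow> bool" where
  "pre_leibniz_algebroid E \<rho> br \<longleftrightarrow>
     anchored_vector_bundle E \<rho> \<and>
     real_bilinear_on_sections E br \<and>
     (\<forall>u\<in>sections E. \<forall>v\<in>sections E.
        (\<forall>f\<in>Cinf E. br u (f *\<^sub>S v) = anchor_deriv \<rho> u f *\<^sub>S v + f *\<^sub>S br u v) \<and>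
        anchor_field \<rho> (br u v) = lie_bracket (anchor_field \<rho> u) (anchor_field \<rho> v))"

definition Cinf_multilinear_operator ::
  "('m::{second_countable_topology,t2_space}, 'e::real_inner, 'v::real_vector) vbundle \<Rightarrow>
     (('m \<Rightarrow> 'v \<Rightarrow> real) \<Rightarrow> ('m \<Rightarrow> 'v) \<Rightarrow> ('m \<Rightarrow> 'v) \<Rightarrow> ('m \<Rightarrow> 'v)) \<Rightarrow> bool" where
  "Cinf_multilinear_operator E L \<longleftrightarrow>
     (\<forall>\<omega>\<in>one_forms E. \<forall>u\<in>sections E. \<forall>v\<in>sections E.
        L \<omega> u v \<in> sections E \<and>
        (\<forall>\<omega>'\<in>one_forms E. L (\<omega> + \<omega>') u v = L \<omega> u v + L \<omega>' u v) \<and>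
        (\<forall>u'\<in>sections E. L \<omega> (u + u') v = L \<omega> u v + L \<omega> u' v) \<and>
        (\<forall>v'\<in>sections E. L \<omega> u (v + v') = L \<omega> u v + L \<omega> u v') \<and>
        (\<forall>f\<in>Cinf E. L (f *\<^sub>F \<omega>) u v = f *\<^sub>S L \<omega> u v \<and>
                     L \<omega> (f *\<^sub>S u) v = f *\<^sub>S L \<omega> u v \<and>
                     L \<omega> u (f *\<^sub>S v) = f *\<^sub>S L \<omega> u v))"

definition local_pre_leibniz_algebroid ::
  "('m::{second_countable_topology,t2_space}, 'e::real_inner, 'v::real_vector) vbundle \<Rightarrow>
     ('m \<Rightarrow> 'v \<Rightarrow> ('m \<Rightarrow> real) \<Rightarrow> real) \<Rightarrow>
     (('m \<Rightarrow> 'v) \<Rightarrow> ('m \<Rightarrow> 'v) \<Rightarrow> ('m \<Rightarrow> 'v)) \<Rightarrow>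
     (('m \<Rightarrow> 'v \<Rightarrow> real) \<Rightarrow> ('m \<Rightarrow> 'v) \<Rightarrow> ('m \<Rightarrow> 'v) \<Rightarrow> ('m \<Rightarrow> 'v)) \<Rightarrow> bool" where
  "local_pre_leibniz_algebroid E \<rho> br L \<longleftrightarrow>
     pre_leibniz_algebroid E \<rho> br \<and>
     Cinf_multilinear_operator E L \<and>
     (\<forall>u\<in>sections E. \<forall>v\<in>sections E. \<forall>f\<in>Cinf E.
        br (f *\<^sub>S u) v = - (anchor_deriv \<rho> v f *\<^sub>S u) + f *\<^sub>S br u v + L (D_form E \<rho> f) u v)"

definition locality_projector ::
  "('m::{second_countable_topology,t2_space}, 'e::real_inner, 'v::real_vector) vbundle \<Rightarrow>
     ('m \<Rightarrow> 'v \<Rightarrow> ('m \<Rightarrow> real) \<Rightarrow> real) \<Rightarrow>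
     (('m \<Rightarrow> 'v \<Rightarrow> real) \<Rightarrow> ('m \<Rightarrow> 'v) \<Rightarrow> ('m \<Rightarrow> 'v) \<Rightarrow> ('m \<Rightarrow> 'v)) \<Rightarrow>
     (('m \<Rightarrow> 'v) \<Rightarrow> ('m \<Rightarrow> 'v)) \<Rightarrow> bool" where
  "locality_projector E \<rho> L P \<longleftrightarrow>
     (\<forall>u\<in>sections E. P u \<in> sections E \<and>
        (\<forall>v\<in>sections E. P (u + v) = P u + P v) \<and>
        (\<forall>f\<in>Cinf E. P (f *\<^sub>S u) = f *\<^sub>S P u)) \<and>
     (\<forall>\<omega>\<in>one_forms E. \<forall>u\<in>sections E. \<forall>v\<in>sections E. \<forall>p. P (L \<omega> u v) p \<in> anchor_kernel E \<rho> p) \<and>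
     (\<forall>u\<in>sections E. (\<forall>p. u p \<in> anchor_kernel E \<rho> p) \<longrightarrow> P u = u)"

section \<open>Linear E-connections\<close>

text \<open>\<open>nab u v\<close> stands for \<open>\<nabla>\<^sub>u v\<close>.\<close>

definition linear_E_connection ::
  "('m::{second_countable_topology,t2_space}, 'e::real_inner, 'v::real_vector) vbundle \<Rightarrow>
     ('m \<Rightarrow> 'v \<Rightarrow> ('m \<Rightarrow> real) \<Rightarrow> real) \<Rightarrow>
     (('m \<Rightarrow> 'v) \<Rightarrow> ('m \<Rightarrow> 'v) \<Rightarrow> ('m \<Rightarrow> 'v)) \<Rightarrow> bool" where
  "linear_E_connection E \<rho> nab \<longleftrightarrow>
     real_bilinear_on_sections E nab \<and>
     (\<forall>u\<in>sections E. \<forall>v\<in>sections E. \<forall>f\<in>Cinf E.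
        nab u (f *\<^sub>S v) = anchor_deriv \<rho> u f *\<^sub>S v + f *\<^sub>S nab u v \<and>
        nab (f *\<^sub>S u) v = f *\<^sub>S nab u v)"

text \<open>
  \<open>nab\<close> and \<open>L\<close> act on global sections. To evaluate \<open>L(e\<^sup>a, \<nabla>\<^bsub>X\<^sub>a\<^esub>u, v)\<close> at a point, a local frame and
  its dual coframe are therefore represented by global sections that restrict to them on an open
  set \<open>U\<close>. After shrinking its domain around a given point, every local frame arises in this way,
  by a cutoff; since the operators are local, the values on \<open>U\<close> do not depend on the extension.
\<close>

definition local_frame ::
  "('m::{second_countable_topology,t2_space}, 'e::real_inner, 'v::real_vector) vbundle \<Rightarrow> 'm set \<Rightarrow>
     (nat \<Rightarrow> 'm \<Rightarrow> 'v) \<Rightarrow> (nat \<Rightarrow> 'm \<Rightarrow> 'v \<Rightarrow> real) \<Rightarrow> bool" where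
  "local_frame E U X e \<longleftrightarrow>
     open U \<and>
     (\<forall>a<rk E. X a \<in> sections E \<and> e a \<in> one_forms E) \<and>
     (\<forall>p\<in>U. span ((\<lambda>a. X a p) ` {..<rk E}) = fibre E p \<and>
             (\<forall>a<rk E. \<forall>b<rk E. e a p (X b p) = (if a = b then 1 else 0)))"

text \<open>
  The section \<open>L(e\<^sup>a, \<nabla>\<^bsub>X\<^sub>a\<^esub>u, v)\<close>. The choice of the frame around each point is immaterial, as the
  sum is frame-independent.
\<close>

definition L_contr ::
  "('m::{second_countable_topology,t2_space}, 'e::real_inner, 'v::real_vector) vbundle \<Rightarrow>
     (('m \<Rightarrow> 'v \<Rightarrow> real) \<Rightarrow> ('m \<Rightarrow> 'v) \<Rightarrow> ('m \<Rightarrow> 'v) \<Rightarrow> ('m \<Rightarrow> 'v)) \<Rightarrow>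
     (('m \<Rightarrow> 'v) \<Rightarrow> ('m \<Rightarrow> 'v) \<Rightarrow> ('m \<Rightarrow> 'v)) \<Rightarrow>
     ('m \<Rightarrow> 'v) \<Rightarrow> ('m \<Rightarrow> 'v) \<Rightarrow> 'm \<Rightarrow> 'v" where
  "L_contr E L nab u v = (\<lambda>p.
     case SOME (X, e). \<exists>U. p \<in> U \<and> local_frame E U X e of
       (X, e) \<Rightarrow> \<Sum>a<rk E. L (e a) (nab (X a) u) v p)"

definition admissible_connection ::
  "('m::{second_countable_topology,t2_space}, 'e::real_inner, 'v::real_vector) vbundle \<Rightarrow>
     (('m \<Rightarrow> 'v) \<Rightarrow> ('m \<Rightarrow> 'v) \<Rightarrow> ('m \<Rightarrow> 'v)) \<Rightarrow>
     (('m \<Rightarrow> 'v \<Rightarrow> real) \<Rightarrow> ('m \<Rightarrow> 'v) \<Rightarrow> ('m \<Rightarrow> 'v) \<Rightarrow> ('m \<Rightarrow> 'v)) \<Rightarrow>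
     (('m \<Rightarrow> 'v) \<Rightarrow> ('m \<Rightarrow> 'v) \<Rightarrow> ('m \<Rightarrow> 'v)) \<Rightarrow> bool" where
  "admissible_connection E br L nab \<longleftrightarrow>
     (\<forall>u\<in>sections E. \<forall>v\<in>sections E. br u v + br v u = L_contr E L nab u v + L_contr E L nab v u)"

definition proj_bracket ::
  "('m::{second_countable_topology,t2_space}, 'e::real_inner, 'v::real_vector) vbundle \<Rightarrow>
     (('m \<Rightarrow> 'v) \<Rightarrow> ('m \<Rightarrow> 'v) \<Rightarrow> ('m \<Rightarrow> 'v)) \<Rightarrow>
     (('m \<Rightarrow> 'v \<Rightarrow> real) \<Rightarrow> ('m \<Rightarrow> 'v) \<Rightarrow> ('m \<Rightarrow> 'v) \<Rightarrow> ('m \<Rightarrow> 'v)) \<Rightarrow>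
     (('m \<Rightarrow> 'v) \<Rightarrow> ('m \<Rightarrow> 'v)) \<Rightarrow>
     (('m \<Rightarrow> 'v) \<Rightarrow> ('m \<Rightarrow> 'v) \<Rightarrow> ('m \<Rightarrow> 'v)) \<Rightarrow>
     ('m \<Rightarrow> 'v) \<Rightarrow> ('m \<Rightarrow> 'v) \<Rightarrow> ('m \<Rightarrow> 'v)" where
  "proj_bracket E br L P nab u v = br u v - P (L_contr E L nab u v)"

text \<open>Torsion and curvature of \<open>nab\<close> with respect to a bracket \<open>b\<close>.\<close>

definition E_torsion ::
  "(('m \<Rightarrow> 'v) \<Rightarrow> ('m \<Rightarrow> 'v) \<Rightarrow> ('m \<Rightarrow> 'v::real_vector)) \<Rightarrow>
     (('m \<Rightarrow> 'v) \<Rightarrow> ('m \<Rightarrow> 'v) \<Rightarrow> ('m \<Rightarrow> 'v)) \<Rightarrow> ('m \<Rightarrow> 'v) \<Rightarrow> ('m \<Rightarrow> 'v) \<Rightarrow> ('m \<Rightarrow> 'v)" where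
  "E_torsion b nab u v = nab u v - nab v u - b u v"

definition E_curvature ::
  "(('m \<Rightarrow> 'v) \<Rightarrow> ('m \<Rightarrow> 'v) \<Rightarrow> ('m \<Rightarrow> 'v::real_vector)) \<Rightarrow>
     (('m \<Rightarrow> 'v) \<Rightarrow> ('m \<Rightarrow> 'v) \<Rightarrow> ('m \<Rightarrow> 'v)) \<Rightarrow>
     ('m \<Rightarrow> 'v) \<Rightarrow> ('m \<Rightarrow> 'v) \<Rightarrow> ('m \<Rightarrow> 'v) \<Rightarrow> ('m \<Rightarrow> 'v)" where
  "E_curvature b nab u v w = nab u (nab v w) - nab v (nab u w) - nab (b u v) w"

text \<open>The Leibniz extension of \<open>\<nabla>\<^sub>u\<close> to vector-valued tensors with two and with three arguments.\<close>

definition nabla_tensor2 ::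
  "(('m \<Rightarrow> 'v) \<Rightarrow> ('m \<Rightarrow> 'v) \<Rightarrow> ('m \<Rightarrow> 'v::real_vector)) \<Rightarrow>
     ('m \<Rightarrow> 'v) \<Rightarrow> (('m \<Rightarrow> 'v) \<Rightarrow> ('m \<Rightarrow> 'v) \<Rightarrow> ('m \<Rightarrow> 'v)) \<Rightarrow>
     ('m \<Rightarrow> 'v) \<Rightarrow> ('m \<Rightarrow> 'v) \<Rightarrow> ('m \<Rightarrow> 'v)" where
  "nabla_tensor2 nab u T v w = nab u (T v w) - T (nab u v) w - T v (nab u w)"

definition nabla_tensor3 ::
  "(('m \<Rightarrow> 'v) \<Rightarrow> ('m \<Rightarrow> 'v) \<Rightarrow> ('m \<Rightarrow> 'v::real_vector)) \<Rightarrow>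
     ('m \<Rightarrow> 'v) \<Rightarrow> (('m \<Rightarrow> 'v) \<Rightarrow> ('m \<Rightarrow> 'v) \<Rightarrow> ('m \<Rightarrow> 'v) \<Rightarrow> ('m \<Rightarrow> 'v)) \<Rightarrow>
     ('m \<Rightarrow> 'v) \<Rightarrow> ('m \<Rightarrow> 'v) \<Rightarrow> ('m \<Rightarrow> 'v) \<Rightarrow> ('m \<Rightarrow> 'v)" where
  "nabla_tensor3 nab u R v w z =
     nab u (R v w z) - R (nab u v) w z - R v (nab u w) z - R v w (nab u z)"

definition cyclic_sum :: "('s \<Rightarrow> 's \<Rightarrow> 's \<Rightarrow> 's::plus) \<Rightarrow> 's \<Rightarrow> 's \<Rightarrow> 's \<Rightarrow> 's" where
  "cyclic_sum F u v w = F u v w + F v w u + F w u v"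

end

theory Submission
  imports Defs
begin

text \<open>
  Only two properties of the projected modified bracket are used: it is additive on sections, and
  it is antisymmetric. The latter holds because \<open>[u, v] + [v, u]\<close> lies in \<open>ker \<rho>\<close>, so \<open>P\<close> fixes it,
  while admissibility identifies it with the symmetrization of \<open>L(e\<^sup>a, \<nabla>\<^bsub>X\<^sub>a\<^esub>u, v)\<close>. Both identities
  are then formal: the second derivatives cancel, and the commutators \<open>[\<nabla>\<^sub>u, [\<nabla>\<^sub>v, \<nabla>\<^sub>w]]\<close> satisfy the
  Jacobi identity.

  The analytic part is that \<open>L(e\<^sup>a, \<nabla>\<^bsub>X\<^sub>a\<^esub>u, v)\<close> is a smooth section, although the frame is chosen
  separately at each point. Bump functions show that near every point there is a frame made of
  global sections, and that \<open>C\<^sup>\<infinity>\<close>-linear operators on global sections can be expanded in such a frame.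
\<close>

section \<open>Calculus of \<open>C\<^sup>k\<close> functions\<close>

text \<open>As \<open>S\<close> is open, \<open>f\<close> and \<open>g\<close> agree near each of
  its points, so they have the same derivative there, and the induction passes to the
  derivatives.\<close>

lemma Ck_on_cong:
  assumes "open S" "\<And>x. x \<in> S \<Longrightarrow> f x = g x" "Ck_on k S f"
  shows "Ck_on k S g"
  using assms
proof (induction k arbitrary: f g)
  case 0
  then show ?case by (simp cong: continuous_on_cong)
next
  case (Suc k)
  have d: "(g has_derivative frechet_derivative f (at x)) (at x)" if "x \<in> S" for x
    using Suc.prems that frechet_derivative_works has_derivative_transform_within_open
    by (metis Ck_on.simps(2))
  then have "frechet_derivative g (at x) = frechet_derivative f (at x)" if "x \<in> S" for x
    using that frechet_derivative_at by metis
  then have "Ck_on k S (\<lambda>x. frechet_derivative g (at x) v)" for v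
    using Suc.IH[of "\<lambda>x. frechet_derivative f (at x) v"] Suc.prems by simp
  with d show ?case by (auto simp: differentiable_def)
qed

text \<open>Lets smoothness be read off from an explicit derivative formula: uniqueness of
  derivatives identifies \<open>f'\<close> on \<open>S\<close> with the chosen
  \<open>frechet_derivative\<close>.\<close>

lemma Ck_on_SucI:
  assumes "open S" "\<And>x. x \<in> S \<Longrightarrow> (f has_derivative f' x) (at x)"
    "\<And>v. Ck_on k S (\<lambda>x. f' x v)"
  shows "Ck_on (Suc k) S f"
proof -
  have "frechet_derivative f (at x) = f' x" if "x \<in> S" for x
    using assms(2)[OF that] frechet_derivative_at by metis
  then have "Ck_on k S (\<lambda>x. frechet_derivative f (at x) v)" for v
    using Ck_on_cong[OF assms(1) _ assms(3)[of v]] by simp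
  with assms(2) show ?thesis by (auto simp: differentiable_def)
qed

lemma Ck_on_Suc_imp: "Ck_on (Suc k) S f \<Longrightarrow> Ck_on k S f"
proof (induction k arbitrary: f)
  case 0
  then show ?case
    by (auto intro!: continuous_at_imp_continuous_on differentiable_imp_continuous_within)
next
  case (Suc k)
  then show ?case by (metis Ck_on.simps(2))
qed

lemma Ck_on_const: "open S \<Longrightarrow> Ck_on k S (\<lambda>_. c)"
proof (induction k arbitrary: c)
  case (Suc k)
  then show ?case by (intro Ck_on_SucI[where f' = "\<lambda>_ _. 0"]) auto
qed simp

lemma Ck_on_add:
  assumes "open S" "Ck_on k S f" "Ck_on k S g"
  shows "Ck_on k S (\<lambda>x. f x + g x)"
  using assms
proof (induction k arbitrary: f g)
  case (Suc k)
  show ?case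
  proof (rule Ck_on_SucI[OF Suc.prems(1)])
    show "((\<lambda>x. f x + g x) has_derivative
        (\<lambda>v. frechet_derivative f (at x) v + frechet_derivative g (at x) v)) (at x)"
      if "x \<in> S" for x
      using Suc.prems that by (auto intro!: has_derivative_add simp: frechet_derivative_works[symmetric])
  qed (use Suc in auto)
qed (auto intro: continuous_intros)

text \<open>One product rule serves real multiplication and the inner product. Each term of the
  derivative keeps one undifferentiated factor, whose order is lowered by
  \<open>Ck_on_Suc_imp\<close> to match the induction hypothesis.\<close>

lemma (in bounded_bilinear) Ck_on:
  assumes "open S" "Ck_on k S f" "Ck_on k S g"
  shows "Ck_on k S (\<lambda>x. prod (f x) (g x))"
  using assms
proof (induction k arbitrary: f g)
  case 0
  then show ?case by (auto intro: continuous_on)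
next
  case (Suc k)
  show ?case
  proof (rule Ck_on_SucI[OF Suc.prems(1)])
    show "((\<lambda>x. prod (f x) (g x)) has_derivative
        (\<lambda>v. prod (f x) (frechet_derivative g (at x) v) + prod (frechet_derivative f (at x) v) (g x))) (at x)"
      if "x \<in> S" for x
      using Suc.prems that by (auto intro!: FDERIV simp: frechet_derivative_works[symmetric])
    show "Ck_on k S (\<lambda>x. prod (f x) (frechet_derivative g (at x) v)
        + prod (frechet_derivative f (at x) v) (g x))" for v
      using Suc.prems(2,3) Suc.prems(2,3)[THEN Ck_on_Suc_imp]
      by (intro Ck_on_add Suc.IH Suc.prems(1)) simp_all
  qed
qed

lemmas Ck_on_mult = bounded_bilinear.Ck_on[OF bounded_bilinear_mult]

lemmas Ck_on_inner = bounded_bilinear.Ck_on[OF bounded_bilinear_inner]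

text \<open>Since the middle space is the real line, the chain rule gives an ordinary product of the
  derivative of \<open>s\<close> with \<open>h'\<close> composed with \<open>s\<close>. The
  induction therefore varies \<open>h\<close> and keeps \<open>s\<close> fixed.\<close>

lemma Ck_on_compose_real:
  fixes h :: "real \<Rightarrow> real"
  assumes "open S" "Ck_on k UNIV h" "Ck_on k S s"
  shows "Ck_on k S (\<lambda>x. h (s x))"
  using assms
proof (induction k arbitrary: h)
  case 0
  then show ?case by (auto intro: continuous_on_compose2)
next
  case (Suc k)
  have h: "(h has_derivative (\<lambda>v. v * frechet_derivative h (at y) 1)) (at y)" for y
  proof -
    have *: "(h has_derivative frechet_derivative h (at y)) (at y)"
      using Suc.prems frechet_derivative_works by auto
    then interpret bounded_linear "frechet_derivative h (at y)"
      by (rule has_derivative_bounded_linear)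
    \<comment> \<open>A linear map on the reals is multiplication by its value at 1.\<close>
    have "frechet_derivative h (at y) v = v * frechet_derivative h (at y) 1" for v
      using scaleR[of v 1] by simp
    then show ?thesis using * by (metis (no_types, lifting) ext)
  qed
  show ?case
  proof (rule Ck_on_SucI[OF Suc.prems(1)])
    show "((\<lambda>x. h (s x)) has_derivative
        (\<lambda>v. frechet_derivative s (at x) v * frechet_derivative h (at (s x)) 1)) (at x)"
      if "x \<in> S" for x
    proof (rule has_derivative_compose[where g = h
          and g' = "\<lambda>v. v * frechet_derivative h (at (s x)) 1"])
      show "(h has_derivative (\<lambda>v. v * frechet_derivative h (at (s x)) 1)) (at (s x))" by (rule h)
      show "(s has_derivative frechet_derivative s (at x)) (at x)"
        using Suc.prems(3) that by (simp add: frechet_derivative_works[symmetric])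
    qed
    show "Ck_on k S (\<lambda>x. frechet_derivative s (at x) v * frechet_derivative h (at (s x)) 1)" for v
    proof (rule Ck_on_mult[OF Suc.prems(1)])
      show "Ck_on k S (\<lambda>x. frechet_derivative h (at (s x)) 1)"
        using Suc.prems(2) Ck_on_Suc_imp[OF Suc.prems(3)]
        by (intro Suc.IH[where h = "\<lambda>y. frechet_derivative h (at y) 1"] Suc.prems(1)) simp_all
    qed (use Suc.prems(3) in simp)
  qed
qed

lemma Ck_on_Un:
  assumes "open S" "open T" "Ck_on k S f" "Ck_on k T f"
  shows "Ck_on k (S \<union> T) f"
  using assms by (induction k arbitrary: f) (auto intro: continuous_on_open_Un)

lemma Ck_on_subset: "Ck_on k T f \<Longrightarrow> S \<subseteq> T \<Longrightarrow> Ck_on k S f"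
  by (induction k arbitrary: f) (auto intro: continuous_on_subset)

lemma Ck_on_UN:
  assumes "\<And>i. i \<in> I \<Longrightarrow> open (S i)" "\<And>i. i \<in> I \<Longrightarrow> Ck_on k (S i) f"
  shows "Ck_on k (\<Union>i\<in>I. S i) f"
  using assms by (induction k arbitrary: f) (auto intro: continuous_on_open_UN)

section \<open>A flat function and a smooth step on the real line\<close>

definition flat_exp :: "nat \<Rightarrow> real \<Rightarrow> real" where
  "flat_exp n x = (if x > 0 then exp (- 1 / x) / x ^ n else 0)"

text \<open>The powers of \<open>x\<close> in the denominator make the family closed under
  differentiation up to linear combination. Smoothness of all members then follows by one induction,
  and \<open>n = 0\<close> is the classical flat function.\<close>

lemma flat_exp_DERIV:
  "(flat_exp n has_field_derivative (flat_exp (n + 2) x - n * flat_exp (n + 1) x)) (at x)"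
proof -
  consider "x > 0" | "x < 0" | "x = 0" by linarith
  then show ?thesis
  proof cases
    case 1
    \<comment> \<open>For \<open>n = 0\<close> the truncated exponent is harmless, because the
      factor \<open>n\<close> makes both sides vanish.\<close>
    then have pw: "real n * x ^ (n - Suc 0) = real n * x ^ n / x"
      by (cases n) auto
    have "((\<lambda>x. exp (- 1 / x) / x ^ n) has_field_derivative
        (flat_exp (n + 2) x - n * flat_exp (n + 1) x)) (at x)"
      using 1 by (auto intro!: derivative_eq_intros simp: flat_exp_def pw field_simps power2_eq_square)
    then show ?thesis
      by (rule has_field_derivative_transform_within_open[where S = "{0<..}"])
        (use 1 in \<open>auto simp: flat_exp_def\<close>)
  next
    case 2
    have "((\<lambda>x. 0) has_field_derivative (flat_exp (n + 2) x - n * flat_exp (n + 1) x)) (at x)"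
      using 2 by (auto simp: flat_exp_def)
    then show ?thesis
      by (rule has_field_derivative_transform_within_open[where S = "{..<0}"])
        (use 2 in \<open>auto simp: flat_exp_def\<close>)
  next
    case 3
    have "((\<lambda>h. flat_exp n h / h) \<longlongrightarrow> 0) (at 0)"
    proof (rule filterlim_split_at)
      have "\<forall>\<^sub>F h in at_left 0. 0 = flat_exp n h / h"
        unfolding eventually_at_left_field by (auto simp: flat_exp_def intro: exI[of _ "-1"])
      then show "((\<lambda>h. flat_exp n h / h) \<longlongrightarrow> 0) (at_left 0)"
        by (rule Lim_transform_eventually[OF tendsto_const])
      have "\<forall>\<^sub>F h in at_right 0. exp (- 1 / h) / h ^ n / h = flat_exp n h / h"
        unfolding eventually_at_right_field by (auto simp: flat_exp_def intro: exI[of _ "1"])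
      \<comment> \<open>Substituting \<open>h = 1 / t\<close> turns the quotient into
        \<open>t ^ Suc n / exp t\<close>, which tends to 0 as \<open>t\<close> grows.\<close>
      moreover have "((\<lambda>h::real. exp (- 1 / h) / h ^ n / h) \<longlongrightarrow> 0) (at_right 0)"
        using tendsto_power_div_exp_0[of "Suc n"]
        by (simp add: filterlim_at_right_to_top exp_minus field_simps)
      ultimately show "((\<lambda>h. flat_exp n h / h) \<longlongrightarrow> 0) (at_right 0)"
        by (rule Lim_transform_eventually[rotated])
    qed
    then show ?thesis using 3 by (simp add: DERIV_def flat_exp_def)
  qed
qed

lemma flat_exp_Ck: "Ck_on k UNIV (flat_exp n)"
proof (induction k arbitrary: n)
  case 0
  then show ?case
    by (auto intro!: continuous_at_imp_continuous_on DERIV_isCont[OF flat_exp_DERIV])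
next
  case (Suc k)
  show ?case
  proof (rule Ck_on_SucI[OF open_UNIV])
    show "(flat_exp n has_derivative (\<lambda>v. (flat_exp (n + 2) x + (- real n) * flat_exp (n + 1) x) * v)) (at x)" for x
      using flat_exp_DERIV[of n x] by (simp add: has_field_derivative_def)
    show "Ck_on k UNIV (\<lambda>x. (flat_exp (n + 2) x + (- real n) * flat_exp (n + 1) x) * v)" for v
      by (intro Ck_on_mult Ck_on_add Suc Ck_on_const open_UNIV)
  qed
qed

text \<open>Composing the flat function with itself leaves only a constant denominator, so sums,
  products and compositions suffice for smoothness. For \<open>x \<le> 0\<close> the inner function
  has its constant value \<open>flat_exp 0 1\<close>, which the last factor normalizes to 1.\<close>

lemma smooth_step:
  obtains h :: "real \<Rightarrow> real" where "smooth_on UNIV h"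
    "\<And>x. x \<le> 0 \<Longrightarrow> h x = 1" "\<And>x. x \<ge> 1 \<Longrightarrow> h x = 0"
proof -
  \<comment> \<open>\<open>flat_exp 0\<close> is monotone, so the inner difference is nonpositive exactly for \<open>x \<ge> 1\<close>.\<close>
  define h where "h x = flat_exp 0 (flat_exp 0 1 + (-1) * flat_exp 0 x) * (1 / flat_exp 0 (flat_exp 0 1))"
    for x
  have "Ck_on k UNIV h" for k
  proof -
    have "Ck_on k UNIV (\<lambda>x. flat_exp 0 1 + (-1) * flat_exp 0 x)"
      by (intro Ck_on_add Ck_on_mult flat_exp_Ck Ck_on_const open_UNIV)
    from Ck_on_compose_real[OF open_UNIV flat_exp_Ck this] show ?thesis
      unfolding h_def by (intro Ck_on_mult Ck_on_const open_UNIV)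
  qed
  then have "smooth_on UNIV h"
    by (simp add: smooth_on_def)
  moreover have "h x = 1" if "x \<le> 0" for x using that by (simp add: h_def flat_exp_def)
  moreover have "h x = 0" if "x \<ge> 1" for x using that by (simp add: h_def flat_exp_def)
  ultimately show thesis by (rule that)
qed

text \<open>The model space is an inner product space with a finite spanning set, so compactness is
  proved by hand: in terms of an orthogonal spanning set, the ball at 0 is a closed subset of a box
  of bounded coefficients. A translation gives the other centres.\<close>

lemma compact_cball_finite_span:
  fixes B :: "'a::real_inner set"
  assumes "finite B" "span B = UNIV"
  shows "compact (cball (x::'a) r)"
proof -
  obtain C :: "'a set" where C: "finite C" "span C = UNIV" "pairwise orthogonal C"
    using basis_orthogonal[OF assms(1)] assms(2) by auto
  \<comment> \<open>A box is a Minkowski sum of segments; each new direction adds one compact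
    segment.\<close>
  have box: "compact {y. \<exists>c. (\<forall>b\<in>D. \<bar>c b\<bar> \<le> k b) \<and> y = (\<Sum>b\<in>D. c b *\<^sub>R b)}"
    if "finite D" for D :: "'a set" and k
    using that
  proof induction
    case empty
    then show ?case by simp
  next
    case (insert d D)
    let ?K = "\<lambda>D. {y. \<exists>c. (\<forall>b\<in>D. \<bar>c b\<bar> \<le> k b) \<and> y = (\<Sum>b\<in>D. c b *\<^sub>R b)}"
    have "compact ((\<lambda>t. t *\<^sub>R d) ` {- k d..k d})"
      by (intro compact_continuous_image continuous_intros compact_Icc)
    with insert have "compact {y + z |y z. y \<in> (\<lambda>t. t *\<^sub>R d) ` {- k d..k d} \<and> z \<in> ?K D}"
      by (intro compact_sums) auto
    also have "{y + z |y z. y \<in> (\<lambda>t. t *\<^sub>R d) ` {- k d..k d} \<and> z \<in> ?K D} = ?K (insert d D)"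
      (is "?L = ?R")
    proof (intro equalityI subsetI)
      fix a assume "a \<in> ?L"
      then obtain t c where tc: "- k d \<le> t" "t \<le> k d" "\<forall>b\<in>D. \<bar>c b\<bar> \<le> k b"
        "a = t *\<^sub>R d + (\<Sum>b\<in>D. c b *\<^sub>R b)" by auto
      from tc(1,2) have "\<bar>t\<bar> \<le> k d" by linarith
      have "(\<Sum>b\<in>D. (c(d := t)) b *\<^sub>R b) = (\<Sum>b\<in>D. c b *\<^sub>R b)"
        by (rule sum.cong) (use insert in auto)
      then show "a \<in> ?R"
        using tc \<open>\<bar>t\<bar> \<le> k d\<close> insert by (auto intro!: exI[of _ "c(d := t)"])
    next
      fix a assume "a \<in> ?R"
      then obtain c where c: "\<forall>b\<in>insert d D. \<bar>c b\<bar> \<le> k b" "a = (\<Sum>b\<in>insert d D. c b *\<^sub>R b)"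
        by blast
      then have "a = c d *\<^sub>R d + (\<Sum>b\<in>D. c b *\<^sub>R b)"
        by (simp add: insert.hyps)
      moreover from c have "c d *\<^sub>R d \<in> (\<lambda>t. t *\<^sub>R d) ` {- k d..k d}" by (intro imageI) (auto simp: abs_le_iff)
      ultimately show "a \<in> ?L" using c(1) by blast
    qed
    finally show ?case .
  qed
  \<comment> \<open>The bound that Cauchy-Schwarz gives for the Fourier coefficients. The orthogonal
    set may contain 0, where division by zero makes both coefficient and bound 0.\<close>
  define k where "k b = r / norm b" for b :: 'a
  have "cball 0 r \<subseteq> {y. \<exists>c. (\<forall>b\<in>C. \<bar>c b\<bar> \<le> k b) \<and> y = (\<Sum>b\<in>C. c b *\<^sub>R b)}"
  proof
    fix y :: 'a assume y: "y \<in> cball 0 r"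
    define c where "c b = (b \<bullet> y) / (b \<bullet> b)" for b
    \<comment> \<open>The remainder of the Fourier expansion is orthogonal to \<open>C\<close>,
      hence to its span, which is everything, hence to itself.\<close>
    have "y - (\<Sum>b\<in>C. c b *\<^sub>R b) = 0"
    proof -
      let ?z = "y - (\<Sum>b\<in>C. c b *\<^sub>R b)"
      have "orthogonal b ?z" if "b \<in> C" for b
      proof -
        have "(\<Sum>d\<in>C. c d * (b \<bullet> d)) = (\<Sum>d\<in>C. if d = b then c b * (b \<bullet> b) else 0)"
          using C(3) that by (intro sum.cong) (auto simp: pairwise_def orthogonal_def)
        also have "\<dots> = b \<bullet> y" using that C(1) by (simp add: c_def)
        finally show ?thesis by (simp add: orthogonal_def inner_diff_right inner_sum_right)
      qed
      then have "orthogonal ?z ?z"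
        using C(2) by (intro orthogonal_to_span[of ?z C]) (simp_all add: orthogonal_commute)
      then show ?thesis by (simp add: orthogonal_self)
    qed
    moreover have "\<bar>c b\<bar> \<le> k b" for b
    proof (cases "b = 0")
      case False
      have "\<bar>b \<bullet> y\<bar> \<le> norm b * r"
        using Cauchy_Schwarz_ineq2[of b y] y mult_left_mono[of "norm y" r "norm b"]
        by (auto intro: order_trans)
      then have "\<bar>b \<bullet> y\<bar> / (norm b * norm b) \<le> (norm b * r) / (norm b * norm b)"
        by (rule divide_right_mono) simp
      moreover have "\<bar>c b\<bar> = \<bar>b \<bullet> y\<bar> / (norm b * norm b)"
        by (simp add: c_def abs_divide dot_square_norm power2_eq_square)
      ultimately show ?thesis using False by (simp add: k_def)
    qed (simp add: c_def k_def)
    ultimately show "y \<in> {y. \<exists>c. (\<forall>b\<in>C. \<bar>c b\<bar> \<le> k b) \<and> y = (\<Sum>b\<in>C. c b *\<^sub>R b)}"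
      by (auto intro!: exI[of _ c])
  qed
  then have "compact (cball (0::'a) r)"
    using compact_Int_closed[OF box[OF C(1)] closed_cball, of k 0 r] by (simp only: Int_absorb1)
  then have "compact ((+) x ` cball 0 r)" by (rule compact_translation)
  then show ?thesis by (simp add: cball_translation[symmetric])
qed

section \<open>Smooth functions on a manifold\<close>

lemma chart_homeomorphism:
  assumes "smooth_atlas A" "(U, \<phi>) \<in> A"
  shows "open U" "open (\<phi> ` U)" "homeomorphism U (\<phi> ` U) \<phi> (inv_into U \<phi>)"
  using assms unfolding smooth_atlas_def by blast+

lemma chart_image_open:
  assumes "smooth_atlas A" "(U, \<phi>) \<in> A" "open W"
  shows "open (\<phi> ` (U \<inter> W))"
proof -
  note c = chart_homeomorphism[OF assms(1,2)]
  have "openin (top_of_set (\<phi> ` U)) (\<phi> ` (U \<inter> W))"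
    by (rule homeomorphism_imp_open_map[OF c(3)]) (use assms(3) in \<open>auto simp: openin_open\<close>)
  then show ?thesis using c(2) by (simp add: openin_open_eq)
qed

lemma chart_inv:
  assumes "smooth_atlas A" "(U, \<phi>) \<in> A" "q \<in> U"
  shows "inv_into U \<phi> (\<phi> q) = q"
  using homeomorphism_apply1[OF chart_homeomorphism(3)] assms by blast

lemma smooth_fun_onI:
  assumes "\<And>U \<phi> k. (U, \<phi>) \<in> A \<Longrightarrow> Ck_on k (\<phi> ` (U \<inter> W)) (\<lambda>x. f (inv_into U \<phi> x))"
  shows "smooth_fun_on A W f"
  using assms unfolding smooth_fun_on_def smooth_on_def by (auto simp: comp_def)

lemma smooth_fun_onD:
  assumes "smooth_fun_on A W f" "(U, \<phi>) \<in> A"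
  shows "Ck_on k (\<phi> ` (U \<inter> W)) (\<lambda>x. f (inv_into U \<phi> x))"
  using assms unfolding smooth_fun_on_def smooth_on_def comp_def by blast

lemma smooth_fun_on_cong:
  assumes "smooth_atlas A" "open W" "\<And>q. q \<in> W \<Longrightarrow> f q = g q" "smooth_fun_on A W f"
  shows "smooth_fun_on A W g"
proof (rule smooth_fun_onI)
  fix U \<phi> k assume U: "(U, \<phi>) \<in> A"
  show "Ck_on k (\<phi> ` (U \<inter> W)) (\<lambda>x. g (inv_into U \<phi> x))"
    by (rule Ck_on_cong[OF chart_image_open[OF assms(1) U assms(2)] _ smooth_fun_onD[OF assms(4) U]])
      (use assms(3) chart_inv[OF assms(1) U] in auto)
qed

lemma smooth_fun_on_const:
  assumes "smooth_atlas A" "open W"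
  shows "smooth_fun_on A W (\<lambda>_. c)"
  by (intro smooth_fun_onI Ck_on_const chart_image_open[OF assms(1) _ assms(2)])

lemma smooth_fun_on_add:
  assumes "smooth_atlas A" "open W" "smooth_fun_on A W f" "smooth_fun_on A W g"
  shows "smooth_fun_on A W (\<lambda>q. f q + g q)"
  by (intro smooth_fun_onI Ck_on_add smooth_fun_onD[OF assms(3)] smooth_fun_onD[OF assms(4)]
      chart_image_open[OF assms(1) _ assms(2)])

lemma smooth_fun_on_mult:
  assumes "smooth_atlas A" "open W" "smooth_fun_on A W f" "smooth_fun_on A W g"
  shows "smooth_fun_on A W (\<lambda>q. f q * g q)"
  by (intro smooth_fun_onI Ck_on_mult smooth_fun_onD[OF assms(3)] smooth_fun_onD[OF assms(4)]
      chart_image_open[OF assms(1) _ assms(2)])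

lemma smooth_fun_on_sum:
  assumes "smooth_atlas A" "open W" "\<And>i. i \<in> I \<Longrightarrow> smooth_fun_on A W (f i)"
  shows "smooth_fun_on A W (\<lambda>q. \<Sum>i\<in>I. f i q)"
  using assms(3)
  by (induction I rule: infinite_finite_induct)
    (simp_all add: smooth_fun_on_const smooth_fun_on_add assms(1,2))

lemma smooth_fun_on_subset:
  assumes "smooth_fun_on A W f" "V \<subseteq> W"
  shows "smooth_fun_on A V f"
  by (rule smooth_fun_onI, rule Ck_on_subset, erule smooth_fun_onD[OF assms(1)]) (use assms(2) in blast)

text \<open>The chart images of the sets \<open>V q \<inter> W\<close> are an open cover of the
  chart image of \<open>W\<close>, and being of class \<open>Ck_on\<close> passes to unions of open
  sets.\<close>

lemma smooth_fun_on_local: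
  assumes "smooth_atlas A"
    and "\<And>q. q \<in> W \<Longrightarrow> \<exists>V. open V \<and> q \<in> V \<and> smooth_fun_on A (V \<inter> W) f" and "open W"
  shows "smooth_fun_on A W f"
proof (rule smooth_fun_onI)
  fix U \<phi> k assume U: "(U, \<phi>) \<in> A"
  obtain V where V: "\<And>q. q \<in> W \<Longrightarrow> open (V q)" "\<And>q. q \<in> W \<Longrightarrow> q \<in> V q"
    "\<And>q. q \<in> W \<Longrightarrow> smooth_fun_on A (V q \<inter> W) f"
    using assms(2) by metis
  have "Ck_on k (\<Union>q\<in>W. \<phi> ` (U \<inter> (V q \<inter> W))) (\<lambda>x. f (inv_into U \<phi> x))"
    by (intro Ck_on_UN chart_image_open[OF assms(1) U] smooth_fun_onD[OF _ U] open_Int V assms(3))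
  also have "(\<Union>q\<in>W. \<phi> ` (U \<inter> (V q \<inter> W))) = \<phi> ` (U \<inter> W)"
    using V(2) by blast
  finally show "Ck_on k (\<phi> ` (U \<inter> W)) (\<lambda>x. f (inv_into U \<phi> x))" .
qed

text \<open>A smooth step of the squared distance in a chart, extended by 0. The closed set
  \<open>C\<close> containing the support is kept in the conclusion because later extensions by 0
  rely on it.\<close>

lemma bump_function:
  assumes A: "smooth_atlas (A :: ('m::{second_countable_topology,t2_space} set \<times> ('m \<Rightarrow> 'e::real_inner)) set)"
    and W: "open W" "p \<in> W"
  obtains f C N where "smooth_fun_on A UNIV f" "closed C" "C \<subseteq> W" "\<And>q. q \<notin> C \<Longrightarrow> f q = 0"
    "open N" "p \<in> N" "\<And>q. q \<in> N \<Longrightarrow> f q = 1"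
proof -
  have "p \<in> (\<Union>(U, \<phi>)\<in>A. U)"
    using A unfolding smooth_atlas_def by simp
  then obtain U \<phi> where U: "(U, \<phi>) \<in> A" "p \<in> U"
    by auto
  note c = chart_homeomorphism[OF A U(1)] and inv = chart_inv[OF A U(1)]
  note open_im = chart_image_open[OF A U(1)]
  obtain r where r: "r > 0" "cball (\<phi> p) r \<subseteq> \<phi> ` (U \<inter> W)"
    using open_im[OF W(1)] W(2) U(2) open_contains_cball by blast
  obtain h :: "real \<Rightarrow> real" where h: "smooth_on UNIV h"
    "\<And>x. x \<le> 0 \<Longrightarrow> h x = 1" "\<And>x. x \<ge> 1 \<Longrightarrow> h x = 0"
    using smooth_step by blast
  \<comment> \<open>Calibrated to be -1 at the centre, 0 at squared distance
    \<open>r\<^sup>2 / 2\<close> and 1 at distance \<open>r\<close>, so the step is 1 on the inner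
    ball and 0 beyond radius \<open>r\<close>.\<close>
  define s where "s y = (2 / r\<^sup>2) * ((y + - \<phi> p) \<bullet> (y + - \<phi> p)) + - 1" for y
  define f where "f q = (if q \<in> U then h (s (\<phi> q)) else 0)" for q
  define C where "C = inv_into U \<phi> ` cball (\<phi> p) r"
  define N where "N = inv_into U \<phi> ` {y \<in> \<phi> ` U. s y < 0}"
  have s_smooth: "Ck_on k S (\<lambda>x. s (t x))" if "open S" "Ck_on k S t" for S k and t :: "'e \<Rightarrow> 'e"
    unfolding s_def
    by (intro Ck_on_add Ck_on_mult Ck_on_inner Ck_on_const that)
  have "\<exists>B::'e set. finite B \<and> span B = UNIV"
    using A by (simp only: smooth_atlas_def)
  then obtain B :: "'e set" where "finite B" "span B = UNIV"
    by blast
  then have "compact (cball (\<phi> p) r)" by (rule compact_cball_finite_span)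
  moreover have "continuous_on (\<phi> ` U) (inv_into U \<phi>)"
    using c(3) homeomorphism_def by blast
  ultimately have "compact C"
    unfolding C_def using r(2) by (intro compact_continuous_image) (auto intro: continuous_on_subset)
  \<comment> \<open>This is where the Hausdorff property enters: a set closed only in
    \<open>U\<close> would not allow extension by 0.\<close>
  then have "closed C" by (rule compact_imp_closed)
  have "C \<subseteq> W" "C \<subseteq> U"
    using r(2) inv unfolding C_def by fastforce+
  have zero: "f q = 0" if "q \<notin> C" for q
  proof (cases "q \<in> U")
    case True
    then have "\<phi> q \<notin> cball (\<phi> p) r"
      using that inv unfolding C_def by (metis imageI)
    then have "r < norm (\<phi> q - \<phi> p)"
      by (simp add: dist_norm norm_minus_commute)
    then have "r\<^sup>2 \<le> (norm (\<phi> q - \<phi> p))\<^sup>2"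
      using r(1) by (intro power_mono) auto
    then have "s (\<phi> q) \<ge> 1"
      using r(1) by (simp add: s_def power2_norm_eq_inner[symmetric] field_simps)
    then show ?thesis using h(3) by (simp add: f_def)
  qed (simp add: f_def)
  \<comment> \<open>Two open sets cover the manifold: on \<open>U\<close> the function is a smooth
    composite, and on the complement of \<open>C\<close> it is 0.\<close>
  have f_smooth: "smooth_fun_on A UNIV f"
  proof (rule smooth_fun_onI)
    fix V \<psi> k assume V: "(V, \<psi>) \<in> A"
    note open_imV = chart_image_open[OF A V] and invV = chart_inv[OF A V]
    have "\<forall>(V, \<psi>)\<in>A. \<forall>(U, \<phi>)\<in>A. smooth_on (\<psi> ` (V \<inter> U)) (\<phi> \<circ> inv_into V \<psi>)"
      using A unfolding smooth_atlas_def by (elim conjE)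
    then have "Ck_on k (\<psi> ` (V \<inter> U)) (\<phi> \<circ> inv_into V \<psi>)"
      using V U(1) unfolding smooth_on_def by blast
    then have "Ck_on k (\<psi> ` (V \<inter> U)) (\<lambda>x. s ((\<phi> \<circ> inv_into V \<psi>) x))"
      by (rule s_smooth[OF open_imV[OF c(1)]])
    then have "Ck_on k (\<psi> ` (V \<inter> U)) (\<lambda>x. h (s ((\<phi> \<circ> inv_into V \<psi>) x)))"
      by (rule Ck_on_compose_real[OF open_imV[OF c(1)], rotated])
        (use h(1) in \<open>simp add: smooth_on_def\<close>)
    then have 1: "Ck_on k (\<psi> ` (V \<inter> U)) (\<lambda>x. f (inv_into V \<psi> x))"
      by (rule Ck_on_cong[OF open_imV[OF c(1)], rotated]) (auto simp: f_def invV)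
    have "Ck_on k (\<psi> ` (V \<inter> - C)) (\<lambda>_. 0 :: real)"
      using \<open>closed C\<close> by (intro Ck_on_const open_imV) auto
    then have 2: "Ck_on k (\<psi> ` (V \<inter> - C)) (\<lambda>x. f (inv_into V \<psi> x))"
      by (rule Ck_on_cong[rotated 2]) (use \<open>closed C\<close> zero invV in \<open>auto intro: open_imV\<close>)
    have "\<psi> ` (V \<inter> UNIV) = \<psi> ` (V \<inter> U) \<union> \<psi> ` (V \<inter> - C)"
      using \<open>C \<subseteq> U\<close> by blast
    moreover have "open (\<psi> ` (V \<inter> - C))"
      using \<open>closed C\<close> by (intro open_imV) auto
    ultimately show "Ck_on k (\<psi> ` (V \<inter> UNIV)) (\<lambda>x. f (inv_into V \<psi> x))"
      using Ck_on_Un[OF open_imV[OF c(1)] _ 1 2] by (simp only:)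
  qed
  have "continuous_on UNIV s" unfolding s_def by (intro continuous_intros)
  then have "open {y. s y < 0}"
    using open_Collect_less[OF _ continuous_on_const] by blast
  moreover have "N = U \<inter> \<phi> -` {y. s y < 0}"
    using inv unfolding N_def by force
  moreover have "continuous_on U \<phi>" using c(3) homeomorphism_def by blast
  ultimately have "open N" using c(1) continuous_open_preimage by metis
  moreover have "p \<in> N" using U(2) inv unfolding N_def s_def by force
  moreover have "f q = 1" if "q \<in> N" for q
    using that inv h(2) unfolding N_def by (auto simp: f_def)
  ultimately show thesis
    using f_smooth \<open>closed C\<close> \<open>C \<subseteq> W\<close> zero that by blast
qed

section \<open>Sections, forms and frames\<close>

lemma sum_fun_apply: "(\<Sum>i\<in>I. f i) x = (\<Sum>i\<in>I. f i x)"
  by (induction I rule: infinite_finite_induct) auto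

lemma linear_form_on_sum:
  assumes "linear_form_on S l" "subspace S" "\<And>i. i \<in> I \<Longrightarrow> x i \<in> S"
  shows "l (\<Sum>i\<in>I. c i *\<^sub>R x i) = (\<Sum>i\<in>I. c i * l (x i))"
  using assms(3)
proof (induction I rule: infinite_finite_induct)
  case (insert i I)
  have "l (c i *\<^sub>R x i + 1 *\<^sub>R (\<Sum>i\<in>I. c i *\<^sub>R x i)) = c i * l (x i) + 1 * l (\<Sum>i\<in>I. c i *\<^sub>R x i)"
  proof -
    have "x i \<in> S" "(\<Sum>i\<in>I. c i *\<^sub>R x i) \<in> S"
      using insert.prems by (auto intro!: subspace_sum subspace_scale assms(2))
    then show ?thesis
      using assms(1) unfolding linear_form_on_def by blast
  qed
  with insert show ?case by simp
next
  case empty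
  \<comment> \<open>Linearity with both coefficients 0 yields \<open>l 0 = 0\<close>; the infinite
    case also needs it, since such a sum is 0 by convention.\<close>
  have "l (0 *\<^sub>R 0 + 0 *\<^sub>R 0) = 0 * l 0 + 0 * l 0"
    using assms(1) subspace_0[OF assms(2)] unfolding linear_form_on_def by blast
  then show ?case by simp
next
  case (infinite I)
  have "l (0 *\<^sub>R 0 + 0 *\<^sub>R 0) = 0 * l 0 + 0 * l 0"
    using assms(1) subspace_0[OF assms(2)] unfolding linear_form_on_def by blast
  with infinite show ?case by simp
qed

text \<open>The operators are known to be additive on sections or forms only, so the induction also
  carries the membership of partial sums in \<open>S\<close>.\<close>

lemma additive_on_sum:
  fixes A :: "'a::ab_group_add \<Rightarrow> 'b::ab_group_add"
  assumes "0 \<in> S" "\<And>x y. x \<in> S \<Longrightarrow> y \<in> S \<Longrightarrow> x + y \<in> S"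
    and add: "\<And>x y. x \<in> S \<Longrightarrow> y \<in> S \<Longrightarrow> A (x + y) = A x + A y"
    and "\<And>i. i \<in> I \<Longrightarrow> x i \<in> S"
  shows "A (\<Sum>i\<in>I. x i) = (\<Sum>i\<in>I. A (x i))"
proof -
  have zero: "A 0 = 0" using add[OF assms(1,1)] by simp
  have "(\<Sum>i\<in>I. x i) \<in> S \<and> A (\<Sum>i\<in>I. x i) = (\<Sum>i\<in>I. A (x i))"
    using assms(4)
    by (induction I rule: infinite_finite_induct) (simp_all add: zero assms(1,2) add)
  then show ?thesis by blast
qed

section \<open>Sections, one-forms and their pairing\<close>

locale smooth_vector_bundle =
  fixes E :: "('m::{second_countable_topology,t2_space}, 'e::real_inner, 'v::real_vector) vbundle"
  assumes vector_bundle: "vector_bundle E"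
begin

lemma atlas: "smooth_atlas (charts E)"
  using vector_bundle unfolding vector_bundle_def by (elim conjE)

lemma subspace_fibre: "subspace (fibre E p)"
  using vector_bundle unfolding vector_bundle_def by simp

lemma triv_at:
  obtains U \<tau> where "(U, \<tau>) \<in> trivs E" "p \<in> U"
proof -
  have "p \<in> (\<Union>(U, \<tau>)\<in>trivs E. U)"
    using vector_bundle unfolding vector_bundle_def by simp
  then show thesis using that by auto
qed

lemma triv:
  assumes "(U, \<tau>) \<in> trivs E"
  shows triv_open: "open U"
    and triv_bij: "p \<in> U \<Longrightarrow> bij_betw (\<tau> p) (fibre E p) (coord_space (rk E))"
    and triv_linear: "p \<in> U \<Longrightarrow> linear_form_on (fibre E p) (\<lambda>x. \<tau> p x a)"
proof -
  have "\<forall>(U, \<tau>)\<in>trivs E. open U \<and>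
        (\<forall>p\<in>U. bij_betw (\<tau> p) (fibre E p) (coord_space (rk E)) \<and>
                (\<forall>a. linear_form_on (fibre E p) (\<lambda>x. \<tau> p x a)))"
    using vector_bundle unfolding vector_bundle_def by (elim conjE)
  from bspec[OF this assms] show "open U"
    "p \<in> U \<Longrightarrow> bij_betw (\<tau> p) (fibre E p) (coord_space (rk E))"
    "p \<in> U \<Longrightarrow> linear_form_on (fibre E p) (\<lambda>x. \<tau> p x a)"
    by simp_all
qed

lemma transition_smooth:
  assumes "(U, \<tau>) \<in> trivs E" "(V, \<sigma>) \<in> trivs E" "a < rk E" "b < rk E"
  shows "smooth_fun_on (charts E) (U \<inter> V) (\<lambda>p. \<sigma> p (triv_frame E \<tau> a p) b)"
proof -
  have "\<forall>(U, \<tau>)\<in>trivs E. \<forall>(V, \<sigma>)\<in>trivs E. \<forall>a<rk E. \<forall>b<rk E.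
        smooth_fun_on (charts E) (U \<inter> V) (\<lambda>p. \<sigma> p (triv_frame E \<tau> a p) b)"
    using vector_bundle unfolding vector_bundle_def by (elim conjE)
  from bspec[OF this assms(1)] assms(2-) show ?thesis by auto
qed

text \<open>For \<open>a < rk E\<close> the standard basis vector lies in
  \<open>coord_space (rk E)\<close>, the image of the trivialization, so \<open>inv_into\<close>
  really inverts there.\<close>

lemma triv_frame:
  assumes "(U, \<tau>) \<in> trivs E" "p \<in> U" "a < rk E"
  shows triv_frame_fibre: "triv_frame E \<tau> a p \<in> fibre E p"
    and triv_triv_frame: "\<tau> p (triv_frame E \<tau> a p) b = (if b = a then 1 else 0)"
proof -
  have "(\<lambda>b. if b = a then 1 else 0) \<in> \<tau> p ` fibre E p"
    using triv_bij[OF assms(1,2)] assms(3) by (auto simp: bij_betw_def coord_space_def)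
  then show "triv_frame E \<tau> a p \<in> fibre E p"
    "\<tau> p (triv_frame E \<tau> a p) b = (if b = a then 1 else 0)"
    unfolding triv_frame_def by (simp_all add: inv_into_into f_inv_into_f)
qed

text \<open>Both sides lie in the fibre and have the same coordinates, those from
  \<open>rk E\<close> on being 0; injectivity of the trivialization concludes.\<close>

lemma triv_expand:
  assumes "(U, \<tau>) \<in> trivs E" "p \<in> U" "x \<in> fibre E p"
  shows "x = (\<Sum>a<rk E. \<tau> p x a *\<^sub>R triv_frame E \<tau> a p)" (is "_ = ?y")
proof -
  note frame = triv_frame[OF assms(1,2)]
  have y: "?y \<in> fibre E p"
    by (intro subspace_sum subspace_fibre subspace_scale frame) simp
  have "\<tau> p x b = \<tau> p ?y b" for b
  proof (cases "b < rk E")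
    case True
    have "\<tau> p ?y b = (\<Sum>a<rk E. \<tau> p x a * \<tau> p (triv_frame E \<tau> a p) b)"
      by (intro linear_form_on_sum[OF triv_linear[OF assms(1,2)] subspace_fibre] frame) simp
    also have "\<dots> = (\<Sum>a<rk E. if a = b then \<tau> p x b else 0)"
      using frame(2) by (intro sum.cong) auto
    finally show ?thesis using True by simp
  next
    case False
    then show ?thesis
      using bij_betwE[OF triv_bij[OF assms(1,2)]] y assms(3) by (simp add: coord_space_def)
  qed
  then show ?thesis
    using triv_bij[OF assms(1,2)] y assms(3) unfolding bij_betw_def inj_on_def by blast
qed

lemma Cinf_D: "f \<in> Cinf E \<Longrightarrow> smooth_fun_on (charts E) U f"
  unfolding Cinf_def by (auto intro: smooth_fun_on_subset)

lemma Cinf_const: "(\<lambda>_. c) \<in> Cinf E"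
  unfolding Cinf_def by (simp add: smooth_fun_on_const atlas)

lemma Cinf_mult: "f \<in> Cinf E \<Longrightarrow> g \<in> Cinf E \<Longrightarrow> (\<lambda>p. f p * g p) \<in> Cinf E"
  unfolding Cinf_def by (simp add: smooth_fun_on_mult atlas)

lemma sectionsI:
  assumes "\<And>p. u p \<in> fibre E p"
    "\<And>U \<tau> a. (U, \<tau>) \<in> trivs E \<Longrightarrow> a < rk E \<Longrightarrow> smooth_fun_on (charts E) U (\<lambda>p. \<tau> p (u p) a)"
  shows "u \<in> sections E"
  using assms unfolding sections_def by auto

lemma section_fibre: "u \<in> sections E \<Longrightarrow> u p \<in> fibre E p"
  unfolding sections_def by simp

lemma section_smooth:
  "u \<in> sections E \<Longrightarrow> (U, \<tau>) \<in> trivs E \<Longrightarrow> a < rk E \<Longrightarrow> smooth_fun_on (charts E) U (\<lambda>p. \<tau> p (u p) a)"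
  unfolding sections_def by auto

lemma section_add:
  assumes "u \<in> sections E" "v \<in> sections E"
  shows "u + v \<in> sections E"
proof (rule sectionsI)
  show "(u + v) p \<in> fibre E p" for p
    using subspace_add[OF subspace_fibre] section_fibre assms by simp
  fix U \<tau> a assume U: "(U, \<tau>) \<in> trivs E" and a: "a < rk E"
  have "\<tau> p (1 *\<^sub>R u p + 1 *\<^sub>R v p) a = 1 * \<tau> p (u p) a + 1 * \<tau> p (v p) a" if "p \<in> U" for p
    using triv_linear[OF U that] section_fibre assms unfolding linear_form_on_def by blast
  then show "smooth_fun_on (charts E) U (\<lambda>p. \<tau> p ((u + v) p) a)"
    by (intro smooth_fun_on_cong[OF atlas triv_open[OF U] _ smooth_fun_on_add[OF atlas triv_open[OF U]
            section_smooth[OF assms(1) U a] section_smooth[OF assms(2) U a]]]) simp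
qed

lemma section_scale:
  assumes "f \<in> Cinf E" "u \<in> sections E"
  shows "f *\<^sub>S u \<in> sections E"
proof (rule sectionsI)
  show "(f *\<^sub>S u) p \<in> fibre E p" for p
    using subspace_scale[OF subspace_fibre] section_fibre assms by (simp add: scale_section_def)
  fix U \<tau> a assume U: "(U, \<tau>) \<in> trivs E" and a: "a < rk E"
  have "\<tau> p (f p *\<^sub>R u p + 0 *\<^sub>R u p) a = f p * \<tau> p (u p) a + 0 * \<tau> p (u p) a" if "p \<in> U" for p
    using triv_linear[OF U that] section_fibre assms unfolding linear_form_on_def by blast
  then show "smooth_fun_on (charts E) U (\<lambda>p. \<tau> p ((f *\<^sub>S u) p) a)"
    by (intro smooth_fun_on_cong[OF atlas triv_open[OF U] _ smooth_fun_on_mult[OF atlas triv_open[OF U]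
            Cinf_D[OF assms(1)] section_smooth[OF assms(2) U a]]]) (simp add: scale_section_def)
qed

lemma section_zero: "0 \<in> sections E"
proof (rule sectionsI)
  show "0 p \<in> fibre E p" for p
    using subspace_0[OF subspace_fibre] by simp
  fix U \<tau> a assume U: "(U, \<tau>) \<in> trivs E" and a: "a < rk E"
  have "\<tau> p (0 *\<^sub>R 0 + 0 *\<^sub>R 0) a = 0 * \<tau> p 0 a + 0 * \<tau> p 0 a" if "p \<in> U" for p
    using triv_linear[OF U that] subspace_0[OF subspace_fibre] unfolding linear_form_on_def by blast
  then show "smooth_fun_on (charts E) U (\<lambda>p. \<tau> p (0 p) a)"
    by (intro smooth_fun_on_cong[OF atlas triv_open[OF U] _ smooth_fun_on_const[OF atlas triv_open[OF U]]]) simp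
qed

lemma section_sum: "(\<And>i. i \<in> I \<Longrightarrow> u i \<in> sections E) \<Longrightarrow> (\<Sum>i\<in>I. u i) \<in> sections E"
  by (induction I rule: infinite_finite_induct) (simp_all add: section_zero section_add)

lemma section_diff:
  assumes "u \<in> sections E" "v \<in> sections E"
  shows "u - v \<in> sections E"
proof -
  have "u + (\<lambda>_. - 1) *\<^sub>S v \<in> sections E"
    by (intro section_add section_scale Cinf_const assms)
  moreover have "u - v = u + (\<lambda>_. - 1) *\<^sub>S v" by (auto simp: scale_section_def)
  ultimately show ?thesis by (simp only:)
qed

text \<open>Gluing principle for sections defined pointwise; it is what makes \<open>L_contr\<close>
  a section.\<close>

lemma section_local:
  assumes "\<And>p. \<exists>N s. open N \<and> p \<in> N \<and> s \<in> sections E \<and> (\<forall>q\<in>N. u q = s q)"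
  shows "u \<in> sections E"
proof (rule sectionsI)
  show "u p \<in> fibre E p" for p
    using assms[of p] section_fibre by metis
  fix U \<tau> a assume U: "(U, \<tau>) \<in> trivs E" and a: "a < rk E"
  show "smooth_fun_on (charts E) U (\<lambda>p. \<tau> p (u p) a)"
  proof (rule smooth_fun_on_local[OF atlas _ triv_open[OF U]])
    fix q
    obtain N s where N: "open N" "q \<in> N" "s \<in> sections E" "\<forall>q\<in>N. u q = s q"
      using assms by blast
    have "smooth_fun_on (charts E) (N \<inter> U) (\<lambda>p. \<tau> p (s p) a)"
      by (rule smooth_fun_on_subset[OF section_smooth[OF N(3) U a]]) simp
    then have "smooth_fun_on (charts E) (N \<inter> U) (\<lambda>p. \<tau> p (u p) a)"
      by (rule smooth_fun_on_cong[OF atlas, rotated 2]) (use N triv_open[OF U] in auto)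
    with N show "\<exists>N. open N \<and> q \<in> N \<and> smooth_fun_on (charts E) (N \<inter> U) (\<lambda>p. \<tau> p (u p) a)"
      by blast
  qed
qed

lemma one_formsI:
  assumes "\<And>p. linear_form_on (fibre E p) (\<omega> p)" "\<And>p x. x \<notin> fibre E p \<Longrightarrow> \<omega> p x = 0"
    "\<And>U \<tau> a. (U, \<tau>) \<in> trivs E \<Longrightarrow> a < rk E \<Longrightarrow>
      smooth_fun_on (charts E) U (\<lambda>p. \<omega> p (triv_frame E \<tau> a p))"
  shows "\<omega> \<in> one_forms E"
  using assms unfolding one_forms_def by auto

lemma one_form:
  assumes "\<omega> \<in> one_forms E"
  shows one_form_linear: "linear_form_on (fibre E p) (\<omega> p)"
    and one_form_outside: "x \<notin> fibre E p \<Longrightarrow> \<omega> p x = 0"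
    and one_form_smooth: "(U, \<tau>) \<in> trivs E \<Longrightarrow> a < rk E \<Longrightarrow>
      smooth_fun_on (charts E) U (\<lambda>p. \<omega> p (triv_frame E \<tau> a p))"
  using assms unfolding one_forms_def by auto

lemma one_form_zero: "0 \<in> one_forms E"
  by (rule one_formsI) (auto simp: linear_form_on_def intro: smooth_fun_on_const[OF atlas triv_open])

lemma one_form_add:
  assumes "\<omega> \<in> one_forms E" "\<eta> \<in> one_forms E"
  shows "\<omega> + \<eta> \<in> one_forms E"
proof (rule one_formsI)
  show "linear_form_on (fibre E p) ((\<omega> + \<eta>) p)" for p
    using one_form_linear[OF assms(1), of p] one_form_linear[OF assms(2), of p]
    unfolding linear_form_on_def by (simp add: algebra_simps)
qed (simp_all add: one_form_outside assms smooth_fun_on_add[OF atlas triv_open] one_form_smooth)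

lemma one_form_scale:
  assumes "f \<in> Cinf E" "\<omega> \<in> one_forms E"
  shows "f *\<^sub>F \<omega> \<in> one_forms E"
proof (rule one_formsI)
  show "linear_form_on (fibre E p) ((f *\<^sub>F \<omega>) p)" for p
    using one_form_linear[OF assms(2), of p]
    unfolding linear_form_on_def scale_form_def by (simp add: algebra_simps)
qed (simp_all add: scale_form_def one_form_outside assms smooth_fun_on_mult[OF atlas triv_open]
    one_form_smooth Cinf_D)

text \<open>In a trivialization the pairing is a finite sum of products of smooth components. These
  functions serve as coefficients in the frame expansions.\<close>

lemma pairing_Cinf:
  assumes "\<omega> \<in> one_forms E" "u \<in> sections E"
  shows "(\<lambda>p. \<omega> p (u p)) \<in> Cinf E"
  unfolding Cinf_def mem_Collect_eq
proof (rule smooth_fun_on_local[OF atlas _ open_UNIV])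
  fix q
  obtain U \<tau> where U: "(U, \<tau>) \<in> trivs E" "q \<in> U" using triv_at by blast
  have eq: "\<omega> p (u p) = (\<Sum>a<rk E. \<tau> p (u p) a * \<omega> p (triv_frame E \<tau> a p))" if "p \<in> U" for p
    by (subst triv_expand[OF U(1) that section_fibre[OF assms(2)]],
        rule linear_form_on_sum[OF one_form_linear[OF assms(1)] subspace_fibre
          triv_frame_fibre[OF U(1) that]]) simp
  have "smooth_fun_on (charts E) U (\<lambda>p. \<Sum>a<rk E. \<tau> p (u p) a * \<omega> p (triv_frame E \<tau> a p))"
    by (intro smooth_fun_on_sum smooth_fun_on_mult atlas triv_open[OF U(1)] section_smooth assms
        one_form_smooth U(1)) simp_all
  from smooth_fun_on_cong[OF atlas triv_open[OF U(1)] _ this]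
  have "smooth_fun_on (charts E) U (\<lambda>p. \<omega> p (u p))" by (simp add: eq)
  then show "\<exists>V. open V \<and> q \<in> V \<and> smooth_fun_on (charts E) (V \<inter> UNIV) (\<lambda>p. \<omega> p (u p))"
    using U triv_open by auto
qed

section \<open>Frames of global sections near a point, and expansions in them\<close>

lemma bump:
  assumes "open W" "p \<in> W"
  obtains f C N where "f \<in> Cinf E" "closed C" "C \<subseteq> W" "\<And>q. q \<notin> C \<Longrightarrow> f q = 0"
    "open N" "p \<in> N" "\<And>q. q \<in> N \<Longrightarrow> f q = 1"
proof (rule bump_function[OF atlas assms])
  fix f C N
  assume "smooth_fun_on (charts E) UNIV f" "closed C" "C \<subseteq> W" "\<And>q. q \<notin> C \<Longrightarrow> f q = 0"
    "open N" "p \<in> N" "\<And>q. q \<in> N \<Longrightarrow> f q = 1"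
  then show thesis by (intro that[of f C N]) (simp_all add: Cinf_def)
qed

text \<open>The frame and coframe of a trivialization are multiplied by a bump function and extended
  by 0. Their pairing carries the square of the bump, so duality is asserted on
  \<open>N \<inter> U\<close>, where the bump is 1.\<close>

lemma local_frame_exists: "\<exists>U X e. p \<in> U \<and> local_frame E U X e"
proof -
  obtain U \<tau> where U: "(U, \<tau>) \<in> trivs E" "p \<in> U" using triv_at by blast
  note oU = triv_open[OF U(1)]
  obtain f C N where f: "f \<in> Cinf E" "closed C" "C \<subseteq> U" "\<And>q. q \<notin> C \<Longrightarrow> f q = 0"
    "open N" "p \<in> N" "\<And>q. q \<in> N \<Longrightarrow> f q = 1"
    using bump[OF oU U(2)] by blast
  define X where "X a q = (if q \<in> U then f q *\<^sub>R triv_frame E \<tau> a q else 0)" for a q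
  define e where "e a q x = (if q \<in> U \<and> x \<in> fibre E q then f q * \<tau> q x a else 0)" for a q x
  note frame = triv_frame[OF U(1)]
  \<comment> \<open>A function that is smooth over \<open>U\<close> and vanishes off the closed set
    \<open>C \<subseteq> U\<close> is smooth: \<open>U\<close> and the complement of
    \<open>C\<close> form an open cover.\<close>
  have glue: "smooth_fun_on (charts E) V g"
    if "open V" "smooth_fun_on (charts E) (U \<inter> V) g" "\<And>q. q \<in> V \<Longrightarrow> q \<notin> C \<Longrightarrow> g q = 0" for V g
  proof (rule smooth_fun_on_local[OF atlas _ that(1)])
    fix q assume "q \<in> V"
    have "smooth_fun_on (charts E) (- C \<inter> V) g"
      by (rule smooth_fun_on_cong[OF atlas _ _ smooth_fun_on_const[OF atlas, of _ 0]])
        (use that f(2) in \<open>auto simp: open_Compl\<close>)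
    then show "\<exists>W. open W \<and> q \<in> W \<and> smooth_fun_on (charts E) (W \<inter> V) g"
      using that(2) oU f(2,3) by (cases "q \<in> C") (auto simp: open_Compl)
  qed
  have X: "X a \<in> sections E" if a: "a < rk E" for a
  proof (rule sectionsI)
    show "X a q \<in> fibre E q" for q
      using frame(1)[OF _ a] subspace_0[OF subspace_fibre] subspace_scale[OF subspace_fibre]
      by (simp add: X_def)
    fix V \<sigma> b assume V: "(V, \<sigma>) \<in> trivs E" and b: "b < rk E"
    have lin: "\<sigma> q (c *\<^sub>R x) b = c * \<sigma> q x b" if "q \<in> V" "x \<in> fibre E q" for q x c
    proof -
      have "\<sigma> q (c *\<^sub>R x + 0 *\<^sub>R x) b = c * \<sigma> q x b + 0 * \<sigma> q x b"
        using triv_linear[OF V that(1)] that(2) unfolding linear_form_on_def by blast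
      then show ?thesis by simp
    qed
    show "smooth_fun_on (charts E) V (\<lambda>p. \<sigma> p (X a p) b)"
    proof (rule glue[OF triv_open[OF V]])
      have oUV: "open (U \<inter> V)" using oU triv_open[OF V] by blast
      show "smooth_fun_on (charts E) (U \<inter> V) (\<lambda>p. \<sigma> p (X a p) b)"
        by (rule smooth_fun_on_cong[OF atlas oUV _
              smooth_fun_on_mult[OF atlas oUV Cinf_D[OF f(1)] transition_smooth[OF U(1) V a b]]])
          (auto simp: X_def lin frame(1)[OF _ a])
      show "\<sigma> q (X a q) b = 0" if "q \<in> V" "q \<notin> C" for q
        using lin[OF that(1) subspace_0[OF subspace_fibre], of 0] f(4)[OF that(2)] by (simp add: X_def)
    qed
  qed
  have e: "e a \<in> one_forms E" if a: "a < rk E" for a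
  proof (rule one_formsI)
    show "linear_form_on (fibre E q) (e a q)" for q
    proof (cases "q \<in> U")
      case True
      then show ?thesis
        using triv_linear[OF U(1) True, of a] subspace_fibre
        unfolding linear_form_on_def e_def by (simp add: subspace_add subspace_scale algebra_simps)
    qed (simp add: linear_form_on_def e_def)
    show "e a q x = 0" if "x \<notin> fibre E q" for q x using that by (simp add: e_def)
    fix V \<sigma> b assume V: "(V, \<sigma>) \<in> trivs E" and b: "b < rk E"
    have oUV: "open (U \<inter> V)" using oU triv_open[OF V] by blast
    show "smooth_fun_on (charts E) V (\<lambda>p. e a p (triv_frame E \<sigma> b p))"
    proof (rule glue[OF triv_open[OF V]])
      \<comment> \<open>Components of a form in the frame of \<open>\<sigma>\<close> need the
        transition from \<open>\<sigma>\<close> to \<open>\<tau>\<close>, opposite to the one used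
        for \<open>X\<close>.\<close>
      have "smooth_fun_on (charts E) (U \<inter> V) (\<lambda>p. \<tau> p (triv_frame E \<sigma> b p) a)"
        using transition_smooth[OF V U(1) b a] by (simp add: Int_commute)
      from smooth_fun_on_mult[OF atlas oUV Cinf_D[OF f(1)] this]
      show "smooth_fun_on (charts E) (U \<inter> V) (\<lambda>p. e a p (triv_frame E \<sigma> b p))"
        by (rule smooth_fun_on_cong[OF atlas oUV, rotated])
          (auto simp: e_def triv_frame_fibre[OF V _ b])
      show "e a q (triv_frame E \<sigma> b q) = 0" if "q \<notin> C" for q
        using f(4)[OF that] by (simp add: e_def)
    qed
  qed
  have "local_frame E (N \<inter> U) X e"
    unfolding local_frame_def
  proof (intro conjI ballI allI impI)
    show "open (N \<inter> U)" using f(5) oU by blast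
    show "X a \<in> sections E" "e a \<in> one_forms E" if "a < rk E" for a using X e that by simp_all
    fix q assume q: "q \<in> N \<inter> U"
    then have Xq: "X a q = triv_frame E \<tau> a q" for a using f(7) by (simp add: X_def)
    show "e a q (X b q) = (if a = b then 1 else 0)" if "a < rk E" "b < rk E" for a b
      using q f(7) frame[OF _ that(2)] by (simp add: Xq e_def)
    show "span ((\<lambda>a. X a q) ` {..<rk E}) = fibre E q"
    proof
      show "span ((\<lambda>a. X a q) ` {..<rk E}) \<subseteq> fibre E q"
        using q frame(1) by (intro span_minimal subspace_fibre) (auto simp: Xq)
      show "fibre E q \<subseteq> span ((\<lambda>a. X a q) ` {..<rk E})"
      proof
        fix x assume "x \<in> fibre E q"
        then have "x = (\<Sum>a<rk E. \<tau> q x a *\<^sub>R X a q)"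
          using triv_expand[OF U(1)] q by (simp add: Xq)
        also have "\<dots> \<in> span ((\<lambda>a. X a q) ` {..<rk E})"
          by (intro span_sum span_scale span_base) auto
        finally show "x \<in> span ((\<lambda>a. X a q) ` {..<rk E})" .
      qed
    qed
  qed
  then show ?thesis using f(6) U(2) by blast
qed

text \<open>Spanning supplies some coefficients, and duality identifies them as the values of the
  coframe.\<close>

lemma frame_expand:
  assumes "local_frame E U X e" "p \<in> U" "x \<in> fibre E p"
  shows "x = (\<Sum>a<rk E. e a p x *\<^sub>R X a p)"
proof -
  have sp: "span ((\<lambda>a. X a p) ` {..<rk E}) = fibre E p"
    and dual: "\<And>a b. a < rk E \<Longrightarrow> b < rk E \<Longrightarrow> e a p (X b p) = (if a = b then 1 else 0)"
    and e: "\<And>a. a < rk E \<Longrightarrow> e a \<in> one_forms E" and X: "\<And>a. a < rk E \<Longrightarrow> X a \<in> sections E"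
    using assms unfolding local_frame_def by blast+
  \<comment> \<open>Coefficients are indexed by \<open>a\<close> rather than by the vectors
    \<open>X a p\<close>, so no injectivity of the family is presupposed.\<close>
  have "x \<in> range (\<lambda>c. \<Sum>a<rk E. c a *\<^sub>R X a p)"
  proof -
    have "subspace (range (\<lambda>c. \<Sum>a<rk E. c a *\<^sub>R X a p))"
      unfolding subspace_def
    proof (intro conjI ballI allI)
      show "0 \<in> range (\<lambda>c. \<Sum>a<rk E. c a *\<^sub>R X a p)"
        by (rule range_eqI[of _ _ "\<lambda>_. 0"]) simp
      show "y + z \<in> range (\<lambda>c. \<Sum>a<rk E. c a *\<^sub>R X a p)"
        if "y \<in> range (\<lambda>c. \<Sum>a<rk E. c a *\<^sub>R X a p)" "z \<in> range (\<lambda>c. \<Sum>a<rk E. c a *\<^sub>R X a p)" for y z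
      proof -
        from that obtain c d where "y = (\<Sum>a<rk E. c a *\<^sub>R X a p)" "z = (\<Sum>a<rk E. d a *\<^sub>R X a p)"
          by blast
        then show ?thesis
          by (intro range_eqI[of _ _ "\<lambda>a. c a + d a"]) (simp add: scaleR_add_left sum.distrib)
      qed
      show "r *\<^sub>R y \<in> range (\<lambda>c. \<Sum>a<rk E. c a *\<^sub>R X a p)"
        if "y \<in> range (\<lambda>c. \<Sum>a<rk E. c a *\<^sub>R X a p)" for r y
      proof -
        from that obtain c where "y = (\<Sum>a<rk E. c a *\<^sub>R X a p)"
          by blast
        then show ?thesis
          by (intro range_eqI[of _ _ "\<lambda>a. r * c a"]) (simp add: scaleR_sum_right)
      qed
    qed
    moreover have "X b p \<in> range (\<lambda>c. \<Sum>a<rk E. c a *\<^sub>R X a p)" if "b < rk E" for b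
      using that by (intro range_eqI[of _ _ "\<lambda>a. if a = b then 1 else 0"])
        (simp add: if_distrib[of "\<lambda>t. t *\<^sub>R _"] cong: if_cong)
    ultimately have "span ((\<lambda>a. X a p) ` {..<rk E}) \<subseteq> range (\<lambda>c. \<Sum>a<rk E. c a *\<^sub>R X a p)"
      by (intro span_minimal) auto
    then show ?thesis using assms(3) sp by blast
  qed
  then obtain c where c: "x = (\<Sum>a<rk E. c a *\<^sub>R X a p)" by blast
  have "e b p x = c b" if b: "b < rk E" for b
  proof -
    have "e b p x = (\<Sum>a<rk E. c a * e b p (X a p))"
      unfolding c
      by (rule linear_form_on_sum[OF one_form_linear[OF e[OF b]] subspace_fibre section_fibre[OF X]]) simp
    also have "\<dots> = (\<Sum>a<rk E. if a = b then c b else 0)"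
      using dual[OF b] by (intro sum.cong) auto
    finally show ?thesis using b by simp
  qed
  then have "(\<Sum>a<rk E. e a p x *\<^sub>R X a p) = (\<Sum>a<rk E. c a *\<^sub>R X a p)"
    by (intro sum.cong) auto
  with c show ?thesis by simp
qed

text \<open>The tensoriality argument. The frame expansion of \<open>x\<close> holds only over
  \<open>U\<close>, but after multiplication by a bump function it is an identity of global sections
  to which linearity applies. At \<open>q\<close> the bump is 1 and drops out.\<close>

lemma Cinf_linear_frame:
  fixes A :: "('m \<Rightarrow> 'v) \<Rightarrow> ('m \<Rightarrow> 'w::real_vector)"
  assumes add: "\<And>x y. x \<in> sections E \<Longrightarrow> y \<in> sections E \<Longrightarrow> A (x + y) = A x + A y"
    and scale: "\<And>f x. f \<in> Cinf E \<Longrightarrow> x \<in> sections E \<Longrightarrow> A (f *\<^sub>S x) = f *\<^sub>S A x"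
    and frame: "local_frame E U X e" and "q \<in> U" and x: "x \<in> sections E"
  shows "A x q = (\<Sum>a<rk E. e a q (x q) *\<^sub>R A (X a) q)"
proof -
  have U: "open U" and e: "\<And>a. a < rk E \<Longrightarrow> e a \<in> one_forms E"
    and X: "\<And>a. a < rk E \<Longrightarrow> X a \<in> sections E"
    using frame unfolding local_frame_def by blast+
  obtain f C N where f: "f \<in> Cinf E" "closed C" "C \<subseteq> U" "\<And>p. p \<notin> C \<Longrightarrow> f p = 0"
    "open N" "q \<in> N" "\<And>p. p \<in> N \<Longrightarrow> f p = 1"
    using bump[OF U \<open>q \<in> U\<close>] by blast
  define c where "c a p = f p * e a p (x p)" for a p
  have c: "c a \<in> Cinf E" if "a < rk E" for a
    unfolding c_def using Cinf_mult[OF f(1) pairing_Cinf[OF e[OF that] x]] .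
  have "f p *\<^sub>R x p = (\<Sum>a<rk E. c a p *\<^sub>R X a p)" for p
  proof (cases "p \<in> U")
    case True
    then show ?thesis
      using arg_cong[OF frame_expand[OF frame True section_fibre[OF x]], of "\<lambda>y. f p *\<^sub>R y"]
      by (simp add: c_def scaleR_sum_right)
  next
    case False
    then have "f p = 0" using f(3,4) by blast
    then show ?thesis by (simp add: c_def)
  qed
  then have "f *\<^sub>S x = (\<Sum>a<rk E. c a *\<^sub>S X a)"
    by (intro ext) (simp add: scale_section_def sum_fun_apply)
  then have "A (f *\<^sub>S x) = (\<Sum>a<rk E. A (c a *\<^sub>S X a))"
    using additive_on_sum[of "sections E" A "{..<rk E}" "\<lambda>a. c a *\<^sub>S X a"]
    by (simp add: section_zero section_add section_scale c X add)
  then have "f *\<^sub>S A x = (\<Sum>a<rk E. c a *\<^sub>S A (X a))"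
    by (simp add: scale f(1) x c X)
  then have "(f *\<^sub>S A x) q = (\<Sum>a<rk E. c a *\<^sub>S A (X a)) q" by (rule arg_cong)
  then show ?thesis using f(6,7) by (simp add: scale_section_def sum_fun_apply c_def)
qed

text \<open>Dual to \<open>Cinf_linear_frame\<close>, with the expansion of a form obtained by
  applying it to the frame expansion of a vector.\<close>

lemma Cinf_linear_coframe:
  fixes A :: "('m \<Rightarrow> 'v \<Rightarrow> real) \<Rightarrow> ('m \<Rightarrow> 'w::real_vector)"
  assumes add: "\<And>\<omega> \<eta>. \<omega> \<in> one_forms E \<Longrightarrow> \<eta> \<in> one_forms E \<Longrightarrow> A (\<omega> + \<eta>) = A \<omega> + A \<eta>"
    and scale: "\<And>f \<omega>. f \<in> Cinf E \<Longrightarrow> \<omega> \<in> one_forms E \<Longrightarrow> A (f *\<^sub>F \<omega>) = f *\<^sub>S A \<omega>"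
    and frame: "local_frame E U X e" and "q \<in> U" and \<omega>: "\<omega> \<in> one_forms E"
  shows "A \<omega> q = (\<Sum>a<rk E. \<omega> q (X a q) *\<^sub>R A (e a) q)"
proof -
  have U: "open U" and e: "\<And>a. a < rk E \<Longrightarrow> e a \<in> one_forms E"
    and X: "\<And>a. a < rk E \<Longrightarrow> X a \<in> sections E"
    using frame unfolding local_frame_def by blast+
  obtain f C N where f: "f \<in> Cinf E" "closed C" "C \<subseteq> U" "\<And>p. p \<notin> C \<Longrightarrow> f p = 0"
    "open N" "q \<in> N" "\<And>p. p \<in> N \<Longrightarrow> f p = 1"
    using bump[OF U \<open>q \<in> U\<close>] by blast
  define c where "c a p = f p * \<omega> p (X a p)" for a p
  have c: "c a \<in> Cinf E" if "a < rk E" for a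
    unfolding c_def using Cinf_mult[OF f(1) pairing_Cinf[OF \<omega> X[OF that]]] .
  \<comment> \<open>Forms are functions on all of \<open>'v\<close>, so the identity is also checked
    off the fibre, where the convention makes both sides 0.\<close>
  have "f p * \<omega> p x = (\<Sum>a<rk E. c a p * e a p x)" for p x
  proof (cases "p \<in> U \<and> x \<in> fibre E p")
    case True
    have "\<omega> p (\<Sum>a<rk E. e a p x *\<^sub>R X a p) = (\<Sum>a<rk E. e a p x * \<omega> p (X a p))"
      by (rule linear_form_on_sum[OF one_form_linear[OF \<omega>] subspace_fibre section_fibre[OF X]]) simp
    then have "\<omega> p x = (\<Sum>a<rk E. e a p x * \<omega> p (X a p))"
      using frame_expand[OF frame, of p x] True by simp
    then show ?thesis by (simp add: c_def sum_distrib_left mult_ac)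
  next
    case False
    then consider "f p = 0" | "x \<notin> fibre E p" using f(3,4) by blast
    then show ?thesis
      by cases (simp_all add: c_def one_form_outside[OF \<omega>] one_form_outside[OF e])
  qed
  then have "f *\<^sub>F \<omega> = (\<Sum>a<rk E. c a *\<^sub>F e a)"
    by (intro ext) (simp add: scale_form_def sum_fun_apply)
  then have "A (f *\<^sub>F \<omega>) = (\<Sum>a<rk E. A (c a *\<^sub>F e a))"
    using additive_on_sum[of "one_forms E" A "{..<rk E}" "\<lambda>a. c a *\<^sub>F e a"]
    by (simp add: one_form_zero one_form_add one_form_scale c e add)
  then have "f *\<^sub>S A \<omega> = (\<Sum>a<rk E. c a *\<^sub>S A (e a))"
    by (simp add: scale f(1) \<omega> c e)
  then have "(f *\<^sub>S A \<omega>) q = (\<Sum>a<rk E. c a *\<^sub>S A (e a)) q" by (rule arg_cong)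
  then show ?thesis using f(6,7) by (simp add: scale_section_def sum_fun_apply c_def)
qed

end

section \<open>Elimination rules for the algebraic hypotheses\<close>

lemma real_bilinear_on_sectionsD:
  assumes "real_bilinear_on_sections E F" "u \<in> sections E" "v \<in> sections E"
  shows "F u v \<in> sections E"
    and "w \<in> sections E \<Longrightarrow> F (u + v) w = F u w + F v w"
    and "w \<in> sections E \<Longrightarrow> F w (u + v) = F w u + F w v"
  using assms unfolding real_bilinear_on_sections_def by blast+

lemma linear_E_connectionD:
  assumes "linear_E_connection E \<rho> nab"
  shows "real_bilinear_on_sections E nab"
    and "u \<in> sections E \<Longrightarrow> v \<in> sections E \<Longrightarrow> f \<in> Cinf E \<Longrightarrow> nab (f *\<^sub>S u) v = f *\<^sub>S nab u v"
  using assms unfolding linear_E_connection_def by blast+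

lemma Cinf_multilinear_operatorD:
  assumes "Cinf_multilinear_operator E L"
    and "\<omega> \<in> one_forms E" "u \<in> sections E" "v \<in> sections E"
  shows "L \<omega> u v \<in> sections E"
    and "\<omega>' \<in> one_forms E \<Longrightarrow> L (\<omega> + \<omega>') u v = L \<omega> u v + L \<omega>' u v"
    and "u' \<in> sections E \<Longrightarrow> L \<omega> (u + u') v = L \<omega> u v + L \<omega> u' v"
    and "f \<in> Cinf E \<Longrightarrow> L (f *\<^sub>F \<omega>) u v = f *\<^sub>S L \<omega> u v"
    and "f \<in> Cinf E \<Longrightarrow> L \<omega> (f *\<^sub>S u) v = f *\<^sub>S L \<omega> u v"
proof -
  note 1 = assms(1)[unfolded Cinf_multilinear_operator_def, rule_format, OF assms(2-4)]
  show "L \<omega> u v \<in> sections E"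
    "\<omega>' \<in> one_forms E \<Longrightarrow> L (\<omega> + \<omega>') u v = L \<omega> u v + L \<omega>' u v"
    "u' \<in> sections E \<Longrightarrow> L \<omega> (u + u') v = L \<omega> u v + L \<omega> u' v"
    "f \<in> Cinf E \<Longrightarrow> L (f *\<^sub>F \<omega>) u v = f *\<^sub>S L \<omega> u v"
    "f \<in> Cinf E \<Longrightarrow> L \<omega> (f *\<^sub>S u) v = f *\<^sub>S L \<omega> u v"
    using 1 by blast+
qed

section \<open>The contraction \<open>L(e\<^sup>a, \<nabla>\<^bsub>X\<^sub>a\<^esub>u, v)\<close>\<close>

locale locality_contraction = smooth_vector_bundle E
  for E :: "('m::{second_countable_topology,t2_space}, 'e::real_inner, 'v::real_vector) vbundle" +
  fixes \<rho> :: "'m \<Rightarrow> 'v \<Rightarrow> ('m \<Rightarrow> real) \<Rightarrow> real"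
    and L :: "('m \<Rightarrow> 'v \<Rightarrow> real) \<Rightarrow> ('m \<Rightarrow> 'v) \<Rightarrow> ('m \<Rightarrow> 'v) \<Rightarrow> ('m \<Rightarrow> 'v)"
    and nab :: "('m \<Rightarrow> 'v) \<Rightarrow> ('m \<Rightarrow> 'v) \<Rightarrow> ('m \<Rightarrow> 'v)"
  assumes L: "Cinf_multilinear_operator E L"
    and nab: "linear_E_connection E \<rho> nab"
begin

lemmas nab_D = real_bilinear_on_sectionsD[OF linear_E_connectionD(1)[OF nab]]
  linear_E_connectionD(2)[OF nab]
lemmas L_D = Cinf_multilinear_operatorD[OF L]

text \<open>The same matrix \<open>e' b q (X a q)\<close> expands \<open>X a\<close> in the frame
  \<open>X'\<close> and \<open>e' b\<close> in the coframe \<open>e\<close>. Expanding the first,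
  exchanging the sums and recognizing the second gives the claim.\<close>

lemma contraction_frame_independent:
  assumes fr: "local_frame E U X e" "local_frame E U' X' e'" "q \<in> U" "q \<in> U'"
    and u: "u \<in> sections E" and v: "v \<in> sections E"
  shows "(\<Sum>a<rk E. L (e a) (nab (X a) u) v q) = (\<Sum>b<rk E. L (e' b) (nab (X' b) u) v q)"
proof -
  have e: "\<And>a. a < rk E \<Longrightarrow> e a \<in> one_forms E" "\<And>a. a < rk E \<Longrightarrow> e' a \<in> one_forms E"
    and X: "\<And>a. a < rk E \<Longrightarrow> X a \<in> sections E" "\<And>a. a < rk E \<Longrightarrow> X' a \<in> sections E"
    using fr unfolding local_frame_def by blast+
  have "L (e a) (nab (X a) u) v q = (\<Sum>b<rk E. e' b q (X a q) *\<^sub>R L (e a) (nab (X' b) u) v q)"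
    if "a < rk E" for a
    by (rule Cinf_linear_frame[where A = "\<lambda>x. L (e a) (nab x u) v", OF _ _ fr(2,4) X(1)[OF that]])
      (simp_all add: nab_D L_D e[OF that] u v)
  then have "(\<Sum>a<rk E. L (e a) (nab (X a) u) v q)
    = (\<Sum>a<rk E. \<Sum>b<rk E. e' b q (X a q) *\<^sub>R L (e a) (nab (X' b) u) v q)"
    by simp
  also have "\<dots> = (\<Sum>b<rk E. \<Sum>a<rk E. e' b q (X a q) *\<^sub>R L (e a) (nab (X' b) u) v q)"
    by (rule sum.swap)
  also have "\<dots> = (\<Sum>b<rk E. L (e' b) (nab (X' b) u) v q)"
  proof (rule sum.cong[OF refl])
    fix b assume "b \<in> {..<rk E}"
    then have b: "b < rk E" by simp
    have "L (e' b) (nab (X' b) u) v q = (\<Sum>a<rk E. e' b q (X a q) *\<^sub>R L (e a) (nab (X' b) u) v q)"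
      by (rule Cinf_linear_coframe[where A = "\<lambda>\<omega>. L \<omega> (nab (X' b) u) v", OF _ _ fr(1,3) e(2)[OF b]])
        (simp_all add: nab_D L_D X(2)[OF b] u v)
    then show "(\<Sum>a<rk E. e' b q (X a q) *\<^sub>R L (e a) (nab (X' b) u) v q) = L (e' b) (nab (X' b) u) v q"
      by simp
  qed
  finally show ?thesis .
qed

text \<open>Removes the choice operator from \<open>L_contr\<close>: the given frame witnesses that
  the chosen pair is a frame at \<open>q\<close>, and frame independence compares the two
  sums.\<close>

lemma L_contr_frame:
  assumes "local_frame E U X e" "q \<in> U" "u \<in> sections E" "v \<in> sections E"
  shows "L_contr E L nab u v q = (\<Sum>a<rk E. L (e a) (nab (X a) u) v q)"
proof -
  define F where "F = (\<lambda>(X, e). \<exists>U. q \<in> U \<and> local_frame E U X e)"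
  have "F (X, e)" using assms(1,2) by (auto simp: F_def)
  then have "F (Eps F)" by (rule someI)
  then obtain U' X' e' where *: "Eps F = (X', e')" "q \<in> U'" "local_frame E U' X' e'"
    unfolding F_def by (auto split: prod.splits)
  then have "L_contr E L nab u v q = (\<Sum>a<rk E. L (e' a) (nab (X' a) u) v q)"
    unfolding L_contr_def F_def by simp
  also have "\<dots> = (\<Sum>a<rk E. L (e a) (nab (X a) u) v q)"
    using * assms by (intro contraction_frame_independent)
  finally show ?thesis .
qed

text \<open>By \<open>L_contr_frame\<close> one fixed frame computes the contraction on its whole
  domain, where it is a finite sum of global sections.\<close>

lemma L_contr_section:
  assumes "u \<in> sections E" "v \<in> sections E"
  shows "L_contr E L nab u v \<in> sections E"
proof (rule section_local)
  fix p
  obtain U X e where fr: "p \<in> U" "local_frame E U X e" using local_frame_exists by blast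
  then have U: "open U" and e: "\<And>a. a < rk E \<Longrightarrow> e a \<in> one_forms E"
    and X: "\<And>a. a < rk E \<Longrightarrow> X a \<in> sections E"
    unfolding local_frame_def by blast+
  have "(\<Sum>a<rk E. L (e a) (nab (X a) u) v) \<in> sections E"
    by (intro section_sum) (simp add: L_D nab_D e X assms)
  moreover have "L_contr E L nab u v q = (\<Sum>a<rk E. L (e a) (nab (X a) u) v) q" if "q \<in> U" for q
    using L_contr_frame[OF fr(2) that assms] by (simp add: sum_fun_apply)
  ultimately show "\<exists>N s. open N \<and> p \<in> N \<and> s \<in> sections E \<and> (\<forall>q\<in>N. L_contr E L nab u v q = s q)"
    using U fr(1) by blast
qed

lemma L_contr_add:
  assumes "u \<in> sections E" "v \<in> sections E" "w \<in> sections E"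
  shows "L_contr E L nab (u + v) w = L_contr E L nab u w + L_contr E L nab v w"
proof
  fix p
  obtain U X e where fr: "p \<in> U" "local_frame E U X e" using local_frame_exists by blast
  then have e: "\<And>a. a < rk E \<Longrightarrow> e a \<in> one_forms E"
    and X: "\<And>a. a < rk E \<Longrightarrow> X a \<in> sections E"
    unfolding local_frame_def by blast+
  show "L_contr E L nab (u + v) w p = (L_contr E L nab u w + L_contr E L nab v w) p"
    by (simp add: L_contr_frame[OF fr(2,1)] assms section_add L_D nab_D e X sum.distrib)
qed

end

section \<open>The Bianchi identities\<close>

text \<open>Isolates the formal part, with \<open>S\<close> in the role of the sections. The
  iterated brackets account for the Jacobiator of \<open>B\<close>, which may be nonzero.\<close>

lemma bianchi_of_skew_bracket:
  fixes S :: "('m \<Rightarrow> 'v::real_vector) set"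
  assumes diff_S: "\<And>x y. x \<in> S \<Longrightarrow> y \<in> S \<Longrightarrow> x - y \<in> S"
    and nab_S: "\<And>x y. x \<in> S \<Longrightarrow> y \<in> S \<Longrightarrow> nab x y \<in> S"
    and nab_add: "\<And>x y z. x \<in> S \<Longrightarrow> y \<in> S \<Longrightarrow> z \<in> S \<Longrightarrow> nab (x + y) z = nab x z + nab y z"
      "\<And>x y z. x \<in> S \<Longrightarrow> y \<in> S \<Longrightarrow> z \<in> S \<Longrightarrow> nab z (x + y) = nab z x + nab z y"
    and B_S: "\<And>x y. x \<in> S \<Longrightarrow> y \<in> S \<Longrightarrow> B x y \<in> S"
    and B_add: "\<And>x y z. x \<in> S \<Longrightarrow> y \<in> S \<Longrightarrow> z \<in> S \<Longrightarrow> B (x + y) z = B x z + B y z"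
    and skew: "\<And>x y. x \<in> S \<Longrightarrow> y \<in> S \<Longrightarrow> B x y = - B y x"
    and uvw: "u \<in> S" "v \<in> S" "w \<in> S" "w' \<in> S"
  defines "T \<equiv> E_torsion B nab" and "R \<equiv> E_curvature B nab"
  shows "cyclic_sum (\<lambda>u v w. R u v w) u v w
       = cyclic_sum (\<lambda>u v w. nabla_tensor2 nab u T v w + T (T u v) w + B u (B v w)) u v w"
    and "cyclic_sum (\<lambda>u v w. nabla_tensor3 nab u R v w w') u v w
       = cyclic_sum (\<lambda>u v w. R u (T v w) w' + nab (B (B u v) w) w') u v w"
proof -
  have diff: "A (x - y) = A x - A y"
    if "x \<in> S" "y \<in> S" "\<And>x y. x \<in> S \<Longrightarrow> y \<in> S \<Longrightarrow> A (x + y) = A x + A y"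
    for A :: "('m \<Rightarrow> 'v) \<Rightarrow> ('m \<Rightarrow> 'v)" and x y
    using that(3)[OF diff_S[OF that(1,2)] that(2)] by simp
  have nab_diff1: "nab (x - y) z = nab x z - nab y z" if "x \<in> S" "y \<in> S" "z \<in> S" for x y z
    by (rule diff[of _ _ "\<lambda>x. nab x z"]) (simp_all add: that nab_add)
  have nab_diff2: "nab z (x - y) = nab z x - nab z y" if "x \<in> S" "y \<in> S" "z \<in> S" for x y z
    by (rule diff[of _ _ "nab z"]) (simp_all add: that nab_add)
  have B_diff: "B (x - y) z = B x z - B y z" if "x \<in> S" "y \<in> S" "z \<in> S" for x y z
    by (rule diff[of _ _ "\<lambda>x. B x z"]) (simp_all add: that B_add)
  \<comment> \<open>Closure of \<open>S\<close> is stated for differences, so \<open>- x\<close> is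
    written as \<open>(x - x) - x\<close>.\<close>
  have nab_minus: "nab (- x) z = - nab x z" if "x \<in> S" "z \<in> S" for x z
  proof -
    have "nab ((x - x) - x) z = (nab x z - nab x z) - nab x z"
      using that diff_S by (simp only: nab_diff1)
    then show ?thesis by simp
  qed
  \<comment> \<open>Skewness is oriented so that composite arguments move to the first slot; as a
    general rewrite rule it would apply to its own result.\<close>
  have skew_nab: "B x (nab y z) = - B (nab y z) x" if "x \<in> S" "y \<in> S" "z \<in> S" for x y z
    using skew nab_S that by blast
  have skew_B: "B x (B y z) = - B (B y z) x" if "x \<in> S" "y \<in> S" "z \<in> S" for x y z
    using skew B_S that by blast
  \<comment> \<open>\<open>B_add\<close> concerns the first slot; skewness transfers it to the
    second, where the torsion in \<open>R u (T v w)\<close> puts a difference.\<close>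
  have skew_diff: "B x (y - z) = - (B y x - B z x)" if "x \<in> S" "y \<in> S" "z \<in> S" for x y z
    using skew[OF that(1) diff_S[OF that(2,3)]] B_diff[OF that(2,3,1)] by simp
  note closed = diff_S nab_S B_S uvw
  \<comment> \<open>By skewness of \<open>T\<close>, the terms with \<open>nab\<close> inside
    \<open>T\<close> cancel cyclically against part of \<open>T (T u v) w\<close>. The remaining
    \<open>- T (B u v) w\<close> provides the bracket term of the curvature, cancels the derivatives
    of \<open>B v w\<close>, and its double bracket cancels \<open>B u (B v w)\<close>.\<close>
  show "cyclic_sum (\<lambda>u v w. R u v w) u v w
       = cyclic_sum (\<lambda>u v w. nabla_tensor2 nab u T v w + T (T u v) w + B u (B v w)) u v w"
    unfolding cyclic_sum_def R_def T_def E_torsion_def E_curvature_def nabla_tensor2_def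
    by (simp add: closed nab_diff1 nab_diff2 B_diff skew_nab skew_B)
  \<comment> \<open>By skewness of \<open>R\<close>, the correction terms combine cyclically to
    \<open>R u (T v w) + R u (B v w)\<close>. The commutator in the latter cancels the one from
    differentiating \<open>R\<close>, and its bracket term becomes the double bracket on the
    right.\<close>
  show "cyclic_sum (\<lambda>u v w. nabla_tensor3 nab u R v w w') u v w
       = cyclic_sum (\<lambda>u v w. R u (T v w) w' + nab (B (B u v) w) w') u v w"
    unfolding cyclic_sum_def R_def T_def E_torsion_def E_curvature_def nabla_tensor3_def
    by (simp add: closed nab_diff1 nab_diff2 B_diff skew_nab skew_B skew_diff nab_minus)
qed

theorem proposition3p11:
  fixes E :: "('m::{second_countable_topology,t2_space}, 'e::real_inner, 'v::real_vector) vbundle"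
    and \<rho> :: "'m \<Rightarrow> 'v \<Rightarrow> ('m \<Rightarrow> real) \<Rightarrow> real"
    and br :: "('m \<Rightarrow> 'v) \<Rightarrow> ('m \<Rightarrow> 'v) \<Rightarrow> ('m \<Rightarrow> 'v)"
    and L :: "('m \<Rightarrow> 'v \<Rightarrow> real) \<Rightarrow> ('m \<Rightarrow> 'v) \<Rightarrow> ('m \<Rightarrow> 'v) \<Rightarrow> ('m \<Rightarrow> 'v)"
    and P :: "('m \<Rightarrow> 'v) \<Rightarrow> ('m \<Rightarrow> 'v)"
    and nab :: "('m \<Rightarrow> 'v) \<Rightarrow> ('m \<Rightarrow> 'v) \<Rightarrow> ('m \<Rightarrow> 'v)"
  defines "B \<equiv> proj_bracket E br L P nab"
  defines "T \<equiv> E_torsion B nab"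
  defines "R \<equiv> E_curvature B nab"
  assumes "local_pre_leibniz_algebroid E \<rho> br L"
    and "regular_anchor E \<rho>"
    and "locality_projector E \<rho> L P"
    and "linear_E_connection E \<rho> nab"
    and "admissible_connection E br L nab"
    and "u \<in> sections E" "v \<in> sections E" "w \<in> sections E" "w' \<in> sections E"
  shows "cyclic_sum (\<lambda>u v w. R u v w) u v w
       = cyclic_sum (\<lambda>u v w. nabla_tensor2 nab u T v w + T (T u v) w + B u (B v w)) u v w \<and>
         cyclic_sum (\<lambda>u v w. nabla_tensor3 nab u R v w w') u v w
       = cyclic_sum (\<lambda>u v w. R u (T v w) w' + nab (B (B u v) w) w') u v w"
proof -
  have algebroid: "pre_leibniz_algebroid E \<rho> br" and L: "Cinf_multilinear_operator E L"
    using assms(4) unfolding local_pre_leibniz_algebroid_def by blast+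
  have anchored: "anchored_vector_bundle E \<rho>" and br: "real_bilinear_on_sections E br"
    and anchor_br: "\<And>x y. x \<in> sections E \<Longrightarrow> y \<in> sections E \<Longrightarrow>
      anchor_field \<rho> (br x y) = lie_bracket (anchor_field \<rho> x) (anchor_field \<rho> y)"
    using algebroid unfolding pre_leibniz_algebroid_def by blast+
  have anchor_linear: "\<And>p f. linear_form_on (fibre E p) (\<lambda>x. \<rho> p x f)"
    and vb: "vector_bundle E"
    using anchored unfolding anchored_vector_bundle_def by blast+
  interpret locality_contraction E \<rho> L nab
    using vb L assms(7) by unfold_locales
  note br_D = real_bilinear_on_sectionsD[OF br]
  have P: "\<And>x. x \<in> sections E \<Longrightarrow> P x \<in> sections E"
    and P_add: "\<And>x y. x \<in> sections E \<Longrightarrow> y \<in> sections E \<Longrightarrow> P (x + y) = P x + P y"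
    and P_ker: "\<And>x. x \<in> sections E \<Longrightarrow> (\<forall>p. x p \<in> anchor_kernel E \<rho> p) \<Longrightarrow> P x = x"
    using assms(6) unfolding locality_projector_def by blast+
  have B_section: "B x y \<in> sections E" if "x \<in> sections E" "y \<in> sections E" for x y
    unfolding B_def proj_bracket_def
    by (intro section_diff br_D P L_contr_section that)
  have B_add: "B (x + y) z = B x z + B y z"
    if "x \<in> sections E" "y \<in> sections E" "z \<in> sections E" for x y z
    unfolding B_def proj_bracket_def
    by (simp add: that br_D P_add L_contr_section L_contr_add)
  have skew: "B x y = - B y x" if xy: "x \<in> sections E" "y \<in> sections E" for x y
  proof -
    define s where "s = br x y + br y x"
    have s: "s \<in> sections E" unfolding s_def by (intro section_add br_D xy)
    \<comment> \<open>The anchor sends \<open>s\<close> to the sum of two opposite Lie brackets of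
      vector fields.\<close>
    have "s p \<in> anchor_kernel E \<rho> p" for p
    proof -
      have "\<rho> p (s p) f = 0" for f
      proof -
        have "\<rho> p (1 *\<^sub>R br x y p + 1 *\<^sub>R br y x p) f = 1 * \<rho> p (br x y p) f + 1 * \<rho> p (br y x p) f"
          using anchor_linear[of p f] section_fibre br_D(1) xy unfolding linear_form_on_def by blast
        also have "\<dots> = anchor_field \<rho> (br x y) p f + anchor_field \<rho> (br y x) p f"
          by (simp add: anchor_field_def)
        also have "\<dots> = 0"
          by (simp add: anchor_br xy lie_bracket_def)
        finally show ?thesis by (simp add: s_def)
      qed
      then show ?thesis using section_fibre[OF s] by (simp add: anchor_kernel_def)
    qed
    then have "P s = s" using P_ker s by blast
    moreover have "s = L_contr E L nab x y + L_contr E L nab y x"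
      using assms(8) xy unfolding admissible_connection_def s_def by blast
    \<comment> \<open>Two evaluations of \<open>P s\<close>: once as \<open>s\<close> itself, once
      through admissibility and additivity of \<open>P\<close>. Their equality is the vanishing of
      \<open>B x y + B y x\<close>.\<close>
    ultimately have "P (L_contr E L nab x y) + P (L_contr E L nab y x) = br x y + br y x"
      using P_add[OF L_contr_section L_contr_section] xy s_def by metis
    then have "B x y + B y x = 0"
      unfolding B_def proj_bracket_def by (simp add: algebra_simps)
    then show ?thesis by (simp add: eq_neg_iff_add_eq_0)
  qed
  show ?thesis
    unfolding T_def R_def
    by (intro conjI bianchi_of_skew_bracket[where S = "sections E" and w' = w'] skew
        section_diff nab_D B_section B_add assms(9-12))
qed

end
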